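(* Let $n=1$ and $\mathcal H(x,y,p)=\frac12|p|^2+V(x,y)$, where $V$ has the separable form $V(x,y)=a(x)b(y)+C_0$ with $C_0$ a constant and (i) $a\in C^1(\mathbb{R})$ is bounded with $a(x)>0$ for all $x\in\mathbb{R}$; (ii) $b\in C(\mathbb{T})$ and $\max_{y\in\mathbb{T}}b(y)=0$. Let $u_0\in\mathrm{Lip}(\mathbb{R})\cap\mathrm{BUC}(\mathbb{R})$, let $u^\varepsilon$ be the viscosity solution of the oscillatory Cauchy problem with Hamiltonian $\mathcal H$ and initial datum $u_0$, and let $u$ be the viscosity solution of the corresponding effective Cauchy problem (both defined in the context). Then for each $R,T>0$ there is a constant $C$, depending on $R,T,\mathrm{Lip}(u_0),a(x)$ and $\max|b(y)|$, such that for all $\varepsilon\in(0,1)$ $$\|u^\varepsilon-u\|_{L^\infty([-R,R]\times[0,T])}\le C\varepsilon.$$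
   Context: $\mathbb{T}=\mathbb{R}/\mathbb{Z}$; functions on $\mathbb{T}$ are identified with 1-periodic functions on $\mathbb{R}$. $\mathrm{BUC}(\mathbb{R})$ is the set of bounded uniformly continuous functions on $\mathbb{R}$; $\mathrm{Lip}(\mathbb{R})$ the set of Lipschitz functions and $\mathrm{Lip}(u_0)$ the Lipschitz constant of $u_0$. Oscillatory Cauchy problem: $u^\varepsilon_t+\mathcal H(x,x/\varepsilon,u^\varepsilon_x)=0$ in $\mathbb{R}\times(0,\infty)$, $u^\varepsilon(x,0)=u_0(x)$ on $\mathbb{R}$. Effective Hamiltonian: for each $(x,p)$, $\overline{\mathcal H}(x,p)$ is the unique constant for which the cell problem $\mathcal H(x,y,p+v'(y))=\overline{\mathcal H}(x,p)$, $y\in\mathbb{T}$, has a continuous viscosity solution $v$. Effective Cauchy problem: $u_t+\overline{\mathcal H}(x,u_x)=0$ in $\mathbb{R}\times(0,\infty)$, $u(x,0)=u_0(x)$ on $\mathbb{R}$. *)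

theory Defs
  imports "HOL-Analysis.Analysis" "HOL-Probability.Essential_Supremum"
begin

text \<open>
  Functions on the torus \<open>\<real>/\<int>\<close> are 1-periodic functions on the reals.
  Functions of \<open>(x, t)\<close> are functions on \<^typ>\<open>real \<times> real\<close>.
\<close>

definition one_periodic :: "(real \<Rightarrow> real) \<Rightarrow> bool" where
  "one_periodic f \<longleftrightarrow> (\<forall>y. f (y + 1) = f y)"

definition BUC :: "(real \<Rightarrow> real) set" where
  "BUC = {f. bounded (range f) \<and> uniformly_continuous_on UNIV f}"

definition Lip :: "(real \<Rightarrow> real) set" where
  "Lip = {f. \<exists>L. L-lipschitz_on UNIV f}"

text \<open>The least Lipschitz constant; only meaningful on \<^term>\<open>Lip\<close>.\<close>

definition lip_const :: "(real \<Rightarrow> real) \<Rightarrow> real" where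
  "lip_const f = Inf {L. L-lipschitz_on UNIV f}"

definition is_max :: "('a \<Rightarrow> real) \<Rightarrow> real \<Rightarrow> bool" where
  "is_max f m \<longleftrightarrow> (\<exists>y. f y = m) \<and> (\<forall>y. f y \<le> m)"

definition Linf_norm :: "(real \<times> real) set \<Rightarrow> (real \<times> real \<Rightarrow> real) \<Rightarrow> ereal" where
  "Linf_norm S f = esssup (lebesgue_on S) (\<lambda>z. ereal \<bar>f z\<bar>)"

text \<open>Viscosity solutions on the real line of \<open>F(y, v'(y)) = 0\<close>.\<close>

definition visc_subsol :: "(real \<Rightarrow> real \<Rightarrow> real) \<Rightarrow> (real \<Rightarrow> real) \<Rightarrow> bool" where
  "visc_subsol F v \<longleftrightarrow> (\<forall>\<phi> y0.
     \<phi> C1_differentiable_on UNIV \<and> (\<forall>\<^sub>F y in nhds y0. v y - \<phi> y \<le> v y0 - \<phi> y0)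
       \<longrightarrow> F y0 (deriv \<phi> y0) \<le> 0)"

definition visc_supersol :: "(real \<Rightarrow> real \<Rightarrow> real) \<Rightarrow> (real \<Rightarrow> real) \<Rightarrow> bool" where
  "visc_supersol F v \<longleftrightarrow> (\<forall>\<phi> y0.
     \<phi> C1_differentiable_on UNIV \<and> (\<forall>\<^sub>F y in nhds y0. v y - \<phi> y \<ge> v y0 - \<phi> y0)
       \<longrightarrow> F y0 (deriv \<phi> y0) \<ge> 0)"

text \<open>
  \<open>v\<close> is a continuous viscosity solution of \<open>H(x, y, p + v'(y)) = c\<close> on the torus;
  \<open>x\<close> and \<open>p\<close> are parameters.
\<close>

definition cell_solution ::
  "(real \<Rightarrow> real \<Rightarrow> real \<Rightarrow> real) \<Rightarrow> real \<Rightarrow> real \<Rightarrow> real \<Rightarrow> (real \<Rightarrow> real) \<Rightarrow> bool" where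
  "cell_solution H x p c v \<longleftrightarrow>
     one_periodic v \<and> continuous_on UNIV v \<and>
     visc_subsol (\<lambda>y q. H x y (p + q) - c) v \<and> visc_supersol (\<lambda>y q. H x y (p + q) - c) v"

definition effective_ham ::
  "(real \<Rightarrow> real \<Rightarrow> real \<Rightarrow> real) \<Rightarrow> real \<Rightarrow> real \<Rightarrow> real" where
  "effective_ham H x p = (THE c. \<exists>v. cell_solution H x p c v)"

text \<open>\<open>\<phi>\<close> is \<open>C\<^sup>1\<close> on \<open>\<real> \<times> (0, \<infinity>)\<close> with partial derivatives \<open>\<phi>x\<close>, \<open>\<phi>t\<close>.\<close>

definition C1_with_partials ::
  "(real \<times> real \<Rightarrow> real) \<Rightarrow> (real \<times> real \<Rightarrow> real) \<Rightarrow> (real \<times> real \<Rightarrow> real) \<Rightarrow> bool" where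
  "C1_with_partials \<phi> \<phi>x \<phi>t \<longleftrightarrow>
     continuous_on (UNIV \<times> {0<..}) \<phi>x \<and> continuous_on (UNIV \<times> {0<..}) \<phi>t \<and>
     (\<forall>z \<in> UNIV \<times> {0<..}. (\<phi> has_derivative (\<lambda>(h, k). \<phi>x z * h + \<phi>t z * k)) (at z))"

text \<open>Viscosity sub- and supersolutions of \<open>u_t + F(x, u_x) = 0\<close> in \<open>\<real> \<times> (0, \<infinity>)\<close>.\<close>

definition evol_visc_subsol :: "(real \<Rightarrow> real \<Rightarrow> real) \<Rightarrow> (real \<times> real \<Rightarrow> real) \<Rightarrow> bool" where
  "evol_visc_subsol F u \<longleftrightarrow> (\<forall>\<phi> \<phi>x \<phi>t x0 t0.
     C1_with_partials \<phi> \<phi>x \<phi>t \<and> t0 > 0 \<and>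
     (\<forall>\<^sub>F z in nhds (x0, t0). u z - \<phi> z \<le> u (x0, t0) - \<phi> (x0, t0))
       \<longrightarrow> \<phi>t (x0, t0) + F x0 (\<phi>x (x0, t0)) \<le> 0)"

definition evol_visc_supersol :: "(real \<Rightarrow> real \<Rightarrow> real) \<Rightarrow> (real \<times> real \<Rightarrow> real) \<Rightarrow> bool" where
  "evol_visc_supersol F u \<longleftrightarrow> (\<forall>\<phi> \<phi>x \<phi>t x0 t0.
     C1_with_partials \<phi> \<phi>x \<phi>t \<and> t0 > 0 \<and>
     (\<forall>\<^sub>F z in nhds (x0, t0). u z - \<phi> z \<ge> u (x0, t0) - \<phi> (x0, t0))
       \<longrightarrow> \<phi>t (x0, t0) + F x0 (\<phi>x (x0, t0)) \<ge> 0)"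

text \<open>
  Speaking of \<^emph>\<open>the\<close> viscosity solution of a Cauchy problem on the whole line requires a
  uniqueness class.  We use continuous functions on \<open>\<real> \<times> [0, \<infinity>)\<close> that are bounded on
  \<open>\<real> \<times> [0, T]\<close> for every \<open>T\<close>; this contains the usual class of functions that are bounded and
  uniformly continuous on every such strip.
\<close>

definition cauchy_solution ::
  "(real \<Rightarrow> real \<Rightarrow> real) \<Rightarrow> (real \<Rightarrow> real) \<Rightarrow> (real \<times> real \<Rightarrow> real) \<Rightarrow> bool" where
  "cauchy_solution F u0 u \<longleftrightarrow>
     continuous_on (UNIV \<times> {0..}) u \<and>
     (\<forall>T. bounded (u ` (UNIV \<times> {0..T}))) \<and>
     evol_visc_subsol F u \<and> evol_visc_supersol F u \<and>
     (\<forall>x. u (x, 0) = u0 x)"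

definition oscillatory_solution ::
  "(real \<Rightarrow> real \<Rightarrow> real \<Rightarrow> real) \<Rightarrow> real \<Rightarrow> (real \<Rightarrow> real) \<Rightarrow> (real \<times> real \<Rightarrow> real) \<Rightarrow> bool" where
  "oscillatory_solution H \<epsilon> u0 u \<longleftrightarrow> cauchy_solution (\<lambda>x p. H x (x / \<epsilon>) p) u0 u"

definition effective_solution ::
  "(real \<Rightarrow> real \<Rightarrow> real \<Rightarrow> real) \<Rightarrow> (real \<Rightarrow> real) \<Rightarrow> (real \<times> real \<Rightarrow> real) \<Rightarrow> bool" where
  "effective_solution H u0 u \<longleftrightarrow> cauchy_solution (effective_ham H) u0 u"

definition separable_ham ::
  "(real \<Rightarrow> real) \<Rightarrow> (real \<Rightarrow> real) \<Rightarrow> real \<Rightarrow> real \<Rightarrow> real \<Rightarrow> real \<Rightarrow> real" where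
  "separable_ham a b C0 x y p = (1/2) * \<bar>p\<bar>^2 + (a x * b y + C0)"

end

theory Submission
  imports Defs
begin

text \<open>
The proof rests on the explicit one-dimensional structure of both problems.  After subtracting
\<open>C0\<close>, both Hamiltonians are described by a function \<open>G x e\<close>, the nonnegative momentum at
position \<open>x\<close> with energy \<open>e > 0\<close>: for the oscillatory problem it is
\<open>sqrt (2 * (e - a x * b (x / \<epsilon>)))\<close>, and for the effective problem it is the mean over one
period in \<open>s\<close> of \<open>sqrt (2 * (e - a x * b s))\<close>, because the cell problem with slope \<open>p\<close> is
solvable exactly at the level \<open>e \<ge> 0\<close> at which this mean equals \<open>\<bar>p\<bar>\<close> (or at \<open>e = 0\<close>, if
\<open>\<bar>p\<bar>\<close> is below the mean at \<open>e = 0\<close>).  Such a \<open>G\<close> is concave in the energy, and the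
pair of functions \<open>\<plusminus>(S e x - S e y) - e * t\<close> with \<open>S e\<close> a primitive of \<open>G\<close> are classical
solutions.  Up to an error of order \<open>\<epsilon>\<close>, both solutions are given by the value formula

  \<open>u (x, t) = inf y. u0 y + (sup e. \<bar>S e x - S e y\<bar> - e * t)\<close>,

and the theorem follows from it at once: by periodicity, replacing the oscillatory
momentum by its mean changes \<open>\<bar>S e x - S e y\<bar>\<close> by \<open>O(\<epsilon>)\<close>, uniformly in \<open>e\<close>
(\<open>averaging_error\<close>).  The uniformity is where the separable form enters: the derivative of
\<open>sqrt (2 * (e - a z * \<beta>))\<close> in \<open>z\<close> is bounded, locally in \<open>z\<close>, by a multiple of \<open>sqrt \<bar>\<beta>\<bar>\<close>, even at \<open>e = 0\<close>.

The value formula is proved as two one-sided estimates, up to errors of order \<open>\<epsilon>\<close>, each by a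
single maximum argument with explicit smooth test functions
(\<open>subsol_penalised_maximum\<close>).

  \<^item> Subsolutions lie below the formula.  Along the curve on which a particle of energy \<open>e\<close> moves
    from \<open>y\<close> to \<open>x\<close>, a quadratic penalisation of the distance to the curve is a strict
    supersolution (\<open>subsol_travel\<close>).  If for some \<open>e\<close> the travel time is exactly \<open>t\<close>, this is the
    claim; otherwise slow particles arrive early and have to wait.  Waiting is free in the
    effective problem.  In the oscillatory one it costs \<open>O(\<epsilon>)\<close>, the price of a detour to a zero of
    \<open>b (\<cdot> / \<epsilon>)\<close>, which is at most \<open>\<epsilon>\<close> away (\<open>subsol_wait_near_rest_point\<close>).

  \<^item> Supersolutions lie above the formula.  The logarithm of a sum of exponentials of finitely many
    of the classical solutions is a smooth approximation of their maximum, and convexity makes it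
    an admissible test function (\<open>supersol_lower_bound\<close>).  Finitely many energies suffice
    because \<open>S e\<close> is monotone in \<open>e\<close>.

\<open>subsol_le_supersol\<close> combines the two estimates for a subsolution and a supersolution of two
different Hamiltonians.  Points \<open>y\<close> far from \<open>x\<close> are irrelevant because the action grows
faster than the Lipschitz datum; hence the averaging error enters only on a compact interval, where
\<open>a\<close> is Lipschitz and bounded away from 0.
Using it twice, with the oscillatory and effective problems in either role, gives the rate.
\<close>

section \<open>Penalised maxima of viscosity subsolutions\<close>

text \<open>
The maximisers of \<open>f - n * g\<close> satisfy \<open>g = O(1/n)\<close>, so they accumulate at a zero of \<open>g\<close> that
is at least as good as the given one.
\<close>

lemma compact_penalised_maximum:
  fixes f g :: "'a::metric_space \<Rightarrow> real"
  assumes K: "compact K" and f: "continuous_on K f" and g: "continuous_on K g"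
    and B: "closed B" "B \<subseteq> K" and g0: "\<And>z. z \<in> B \<Longrightarrow> g z \<ge> 0"
    and w: "w \<in> K" "g w = 0"
    and max: "\<And>n::nat. \<exists>z\<in>B. \<forall>w\<in>K. f w - real n * g w \<le> f z - real n * g z"
  shows "\<exists>z\<in>B. g z = 0 \<and> f w \<le> f z"
proof -
  obtain z where z: "\<And>n. z n \<in> B" "\<And>n. f w \<le> f (z n) - real n * g (z n)"
  proof -
    have "\<forall>n. \<exists>z. z \<in> B \<and> f w \<le> f z - real n * g z" using max w by fastforce
    then show ?thesis using that by metis
  qed
  have "compact B" using K B by (metis compact_Int_closed inf.absorb2)
  then obtain l r where l: "l \<in> B" and r: "strict_mono r" and lim: "(z \<circ> r) \<longlonglongrightarrow> l"
    using z(1) unfolding compact_def by metis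
  have zK: "\<And>n. z n \<in> K" and lK: "l \<in> K" using z(1) l B by auto
  have lf: "(\<lambda>n. f (z (r n))) \<longlonglongrightarrow> f l"
    using continuous_on_tendsto_compose[OF f lim lK] zK by (simp add: o_def)
  have lg: "(\<lambda>n. g (z (r n))) \<longlonglongrightarrow> g l"
    using continuous_on_tendsto_compose[OF g lim lK] zK by (simp add: o_def)
  have 1: "f w \<le> f (z (r n))" for n
  proof -
    have "0 \<le> real (r n) * g (z (r n))" using g0[OF z(1)[of "r n"]] by simp
    then show ?thesis using z(2)[of "r n"] by linarith
  qed
  have fl: "f w \<le> f l" using LIMSEQ_le_const[OF lf] 1 by blast
  obtain N where N: "\<And>z. z \<in> K \<Longrightarrow> \<bar>f z\<bar> \<le> N"
    using compact_imp_bounded[OF compact_continuous_image[OF f K]]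
    unfolding bounded_iff by auto
  have "g (z (r n)) \<le> 2 * N / real n" if "n \<ge> 1" for n
  proof -
    have "real (r n) * g (z (r n)) \<le> 2 * N"
      using z(2)[of "r n"] N[OF zK[of "r n"]] N[OF w(1)] by linarith
    moreover have "real n * g (z (r n)) \<le> real (r n) * g (z (r n))"
      using seq_suble[OF r, of n] g0[OF z(1)] by (intro mult_right_mono) auto
    ultimately have "real n * g (z (r n)) \<le> 2 * N" by linarith
    then show ?thesis using that by (simp add: field_simps)
  qed
  then have "g l \<le> 0"
    using tendsto_le[OF sequentially_bot lim_const_over_n lg, of "2 * N"]
    by (auto simp: eventually_sequentially)
  then show ?thesis using l fl g0[OF l] by force
qed

text \<open>
Every estimate of a subsolution below is an instance of this one:
if all functions \<open>Q + n * g\<close> are strict classical supersolutions inside a rectangle, then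
the maxima of \<open>u - Q - n * g\<close> lie on its boundary.  The zero set of \<open>g\<close> on the boundary then
tells where the value of \<open>u - Q\<close> at an interior zero of \<open>g\<close> is controlled from.
\<close>

lemma subsol_penalised_maximum:
  fixes u Q g :: "real \<times> real \<Rightarrow> real"
  assumes sub: "evol_visc_subsol F u"
    and u: "continuous_on ({l..r} \<times> {s..t}) u"
    and Q: "C1_with_partials Q Qx Qt" "continuous_on UNIV Q"
    and g: "C1_with_partials g gx gt" "continuous_on UNIV g" "\<And>z. g z \<ge> 0"
    and s: "0 \<le> s"
    and strict: "\<And>(n::nat) x \<tau>. l < x \<Longrightarrow> x < r \<Longrightarrow> s < \<tau> \<Longrightarrow> \<tau> < t \<Longrightarrow>
      (Qt (x,\<tau>) + real n * gt (x,\<tau>)) + F x (Qx (x,\<tau>) + real n * gx (x,\<tau>)) > 0"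
    and w: "x0 \<in> {l..r}" "t0 \<in> {s..t}" "g (x0,t0) = 0"
  shows "\<exists>x \<tau>. x \<in> {l..r} \<and> \<tau> \<in> {s..t} \<and> (x = l \<or> x = r \<or> \<tau> = s \<or> \<tau> = t) \<and> g (x,\<tau>) = 0 \<and>
           u (x0,t0) - Q (x0,t0) \<le> u (x,\<tau>) - Q (x,\<tau>)"
proof -
  let ?K = "{l..r} \<times> {s..t}"
  let ?B = "{l,r} \<times> {s..t} \<union> {l..r} \<times> {s,t}"
  have B: "closed ?B" "?B \<subseteq> ?K"
    using w(1,2) by (auto intro!: closed_Un closed_Times)
  have cu: "continuous_on ?K (\<lambda>z. u z - Q z)"
    using u Q(2) by (intro continuous_intros) (auto intro: continuous_on_subset)
  have cg: "continuous_on ?K g" using g(2) by (rule continuous_on_subset) auto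
  have max: "\<exists>z\<in>?B. \<forall>w\<in>?K. (u w - Q w) - real n * g w \<le> (u z - Q z) - real n * g z" for n :: nat
  proof -
    have "continuous_on ?K (\<lambda>z. (u z - Q z) - real n * g z)"
      by (intro continuous_intros cu cg)
    then obtain z where z: "z \<in> ?K"
      "\<And>w. w \<in> ?K \<Longrightarrow> (u w - Q w) - real n * g w \<le> (u z - Q z) - real n * g z"
      using continuous_attains_sup[of ?K "\<lambda>z. (u z - Q z) - real n * g z"] w(1,2)
        compact_Times[OF compact_Icc compact_Icc] by blast
    have "z \<in> ?B"
    proof (rule ccontr)
      assume "z \<notin> ?B"
      then obtain x \<tau> where x: "z = (x,\<tau>)" "l < x" "x < r" "s < \<tau>" "\<tau> < t"
        using z(1) by (cases z) (auto simp: less_le)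
      have C1: "C1_with_partials (\<lambda>z. Q z + real n * g z)
          (\<lambda>z. Qx z + real n * gx z) (\<lambda>z. Qt z + real n * gt z)"
        using Q(1) g(1) unfolding C1_with_partials_def
        by (auto intro!: continuous_intros derivative_eq_intros simp: algebra_simps)
      have "open ({l<..<r} \<times> {s<..<t})" "(x,\<tau>) \<in> {l<..<r} \<times> {s<..<t}"
        using x by (auto intro: open_Times)
      then have "\<forall>\<^sub>F w in nhds (x,\<tau>). w \<in> {l<..<r} \<times> {s<..<t}"
        by (rule eventually_nhds_in_open)
      then have "\<forall>\<^sub>F w in nhds (x,\<tau>). u w - (Q w + real n * g w)
          \<le> u (x,\<tau>) - (Q (x,\<tau>) + real n * g (x,\<tau>))"
      proof (rule eventually_mono)
        fix w assume "w \<in> {l<..<r} \<times> {s<..<t}"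
        then have "w \<in> ?K" by auto
        from z(2)[OF this] show "u w - (Q w + real n * g w)
          \<le> u (x,\<tau>) - (Q (x,\<tau>) + real n * g (x,\<tau>))" using x by simp
      qed
      then have "(Qt (x,\<tau>) + real n * gt (x,\<tau>)) + F x (Qx (x,\<tau>) + real n * gx (x,\<tau>)) \<le> 0"
        using sub[unfolded evol_visc_subsol_def, rule_format, OF conjI[OF C1 conjI]] s x by auto
      then show False using strict[of x \<tau> n] x by auto
    qed
    then show ?thesis using z by blast
  qed
  obtain z where z: "z \<in> ?B" "g z = 0" "u (x0,t0) - Q (x0,t0) \<le> u z - Q z"
    using compact_penalised_maximum[OF compact_Times[OF compact_Icc compact_Icc] cu cg B g(3) _ w(3) max]
      w(1,2) by blast
  obtain x \<tau> where x: "z = (x,\<tau>)" by (cases z)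
  with z B(2) have "x \<in> {l..r}" "\<tau> \<in> {s..t}" "x = l \<or> x = r \<or> \<tau> = s \<or> \<tau> = t"
    using w(1,2) by auto
  with z x show ?thesis by blast
qed

text \<open>
This duality transfers the maximum argument above to supersolutions.
\<close>

lemma supersol_imp_subsol_uminus:
  assumes "evol_visc_supersol F v"
  shows "evol_visc_subsol (\<lambda>x p. - F x (- p)) (\<lambda>z. - v z)"
  unfolding evol_visc_subsol_def
proof (intro allI impI, elim conjE)
  fix \<phi> \<phi>x \<phi>t :: "real \<times> real \<Rightarrow> real" and x t :: real
  assume C1: "C1_with_partials \<phi> \<phi>x \<phi>t" and t: "0 < t"
    and ev: "\<forall>\<^sub>F z in nhds (x, t). - v z - \<phi> z \<le> - v (x, t) - \<phi> (x, t)"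
  have "((\<lambda>z. - \<phi> z) has_derivative (\<lambda>(h, k). - \<phi>x z * h + - \<phi>t z * k)) (at z)"
    if "z \<in> UNIV \<times> {0<..}" for z
    using C1 that has_derivative_minus[of \<phi> "\<lambda>(h, k). \<phi>x z * h + \<phi>t z * k"]
    unfolding C1_with_partials_def by (auto simp: case_prod_unfold)
  then have "C1_with_partials (\<lambda>z. - \<phi> z) (\<lambda>z. - \<phi>x z) (\<lambda>z. - \<phi>t z)"
    using C1 unfolding C1_with_partials_def by (auto intro!: continuous_intros)
  moreover have "\<forall>\<^sub>F z in nhds (x, t). v z - - \<phi> z \<ge> v (x, t) - - \<phi> (x, t)"
    using ev by (rule eventually_mono) linarith
  ultimately have "- \<phi>t (x,t) + F x (- \<phi>x (x,t)) \<ge> 0"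
    using assms t unfolding evol_visc_supersol_def by blast
  then show "\<phi>t (x, t) + - F x (- \<phi>x (x, t)) \<le> 0" by linarith
qed

lemma C1_with_partialsI:
  assumes "continuous_on UNIV \<phi>x" "continuous_on UNIV \<phi>t"
    and "\<And>x t. (\<phi> has_derivative (\<lambda>(h, k). \<phi>x (x,t) * h + \<phi>t (x,t) * k)) (at (x,t))"
  shows "C1_with_partials \<phi> \<phi>x \<phi>t \<and> continuous_on UNIV \<phi>"
proof
  show "C1_with_partials \<phi> \<phi>x \<phi>t"
    using assms unfolding C1_with_partials_def by (auto intro: continuous_on_subset)
  show "continuous_on UNIV \<phi>"
    using assms(3) by (auto intro!: continuous_at_imp_continuous_on has_derivative_continuous)
qed

text \<open>
The square of the positive part is the \<open>C\<^sup>1\<close> penalty that keeps maxima away from one side of a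
rectangle without affecting the other side.
\<close>

lemma positive_part_square_derivative:
  "((\<lambda>x::real. (max 0 x)\<^sup>2) has_real_derivative 2 * max 0 x) (at x)"
proof (cases "x = 0")
  case True
  have "((\<lambda>h::real. ((max 0 (0+h))\<^sup>2 - (max 0 0)\<^sup>2) / h) \<longlongrightarrow> 0) (at 0)"
  proof (rule tendsto_0_le[where K = 1 and f = "\<lambda>h::real. h"])
    show "\<forall>\<^sub>F h::real in at 0. norm (((max 0 (0+h))\<^sup>2 - (max 0 0)\<^sup>2) / h) \<le> norm h * 1"
      by (rule always_eventually) (auto simp: max_def power2_eq_square)
  qed (rule tendsto_ident_at)
  then show ?thesis using True by (simp add: DERIV_def)
next
  case False
  consider "x > 0" | "x < 0" using False by linarith
  then show ?thesis
  proof cases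
    case 1
    have "((\<lambda>x::real. x\<^sup>2) has_real_derivative 2 * max 0 x) (at x)"
      using 1 by (auto intro!: derivative_eq_intros)
    then show ?thesis
      by (rule DERIV_cong_ev[THEN iffD1, rotated -1])
        (use 1 in \<open>auto intro!: eventually_mono[OF eventually_nhds_in_open[of "{0<..}" x]]\<close>)
  next
    case 2
    have "((\<lambda>x::real. 0) has_real_derivative 2 * max 0 x) (at x)"
      using 2 by (auto intro!: derivative_eq_intros)
    then show ?thesis
      by (rule DERIV_cong_ev[THEN iffD1, rotated -1])
        (use 2 in \<open>auto intro!: eventually_mono[OF eventually_nhds_in_open[of "{..<0}" x]]\<close>)
  qed
qed

text \<open>
A signed primitive: one of the two integrals vanishes, according to the sign of \<open>x\<close>.
\<close>

definition primitive :: "(real \<Rightarrow> real) \<Rightarrow> real \<Rightarrow> real" where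
  "primitive f x = integral {0..x} f - integral {x..0} f"

lemma primitive_diff:
  assumes "continuous_on UNIV f" "x \<le> y"
  shows "primitive f y - primitive f x = integral {x..y} f"
proof -
  have i: "f integrable_on {c..d}" for c d
    using assms(1) by (intro integrable_continuous_real) (auto intro: continuous_on_subset)
  have c: "integral {c..d} f + integral {d..e} f = integral {c..e} f" if "c \<le> d" "d \<le> e" for c d e
    using Henstock_Kurzweil_Integration.integral_combine[OF that i] .
  consider "0 \<le> x" | "x \<le> 0" "0 \<le> y" | "y \<le> 0" by linarith
  then show ?thesis
  proof cases
    case 1
    then show ?thesis using c[of 0 x y] assms(2) by (cases "x = 0"; cases "y=0") (auto simp: primitive_def)
  next
    case 2
    then show ?thesis using c[of x 0 y] assms(2) by (cases "x = 0"; cases "y=0") (auto simp: primitive_def)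
  next
    case 3
    then show ?thesis using c[of x y 0] assms(2) by (cases "x = 0"; cases "y=0") (auto simp: primitive_def)
  qed
qed

lemma primitive_derivative:
  assumes "continuous_on UNIV f"
  shows "(primitive f has_real_derivative f x) (at x)"
proof -
  have "((\<lambda>y. integral {x - 1..y} f) has_vector_derivative f x) (at x within {x - 1..x + 1})"
    using assms by (intro integral_has_vector_derivative) (auto intro: continuous_on_subset)
  then have "((\<lambda>y. integral {x - 1..y} f) has_real_derivative f x) (at x)"
    by (subst (asm) at_within_Icc_at) (auto simp: has_real_derivative_iff_has_vector_derivative)
  then have "((\<lambda>y. integral {x - 1..y} f + primitive f (x - 1)) has_real_derivative f x) (at x)"
    by (auto intro!: derivative_eq_intros)
  then show ?thesis
    by (rule DERIV_cong_ev[THEN iffD1, rotated -1])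
      (auto intro!: eventually_mono[OF eventually_nhds_in_open[of "{x-1<..}" x]]
        simp: primitive_diff[OF assms, symmetric])
qed

lemma primitive_strict_mono:
  assumes "continuous_on UNIV f" "\<And>x. f x > 0" "x < y"
  shows "primitive f x < primitive f y"
  using assms(3) by (rule DERIV_pos_imp_increasing) (use primitive_derivative[OF assms(1)] assms(2) in blast)

lemma has_derivative_fst_compose:
  assumes "(f has_real_derivative d) (at (fst z))"
  shows "((\<lambda>z. f (fst z)) has_derivative (\<lambda>h. d * fst h)) (at z)"
proof -
  have "((\<lambda>z. f (fst z)) has_derivative (\<lambda>h. d * (fst h))) (at z)"
    by (rule has_derivative_compose[of fst fst z UNIV f "\<lambda>h. d * h"])
      (use assms in \<open>auto intro!: has_derivative_fst has_derivative_ident simp: has_field_derivative_def\<close>)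
  then show ?thesis by simp
qed

lemma has_derivative_snd_compose:
  assumes "(f has_real_derivative d) (at (snd z))"
  shows "((\<lambda>z. f (snd z)) has_derivative (\<lambda>h. d * snd h)) (at z)"
proof -
  have "((\<lambda>z. f (snd z)) has_derivative (\<lambda>h. d * (snd h))) (at z)"
    by (rule has_derivative_compose[of snd snd z UNIV f "\<lambda>h. d * h"])
      (use assms in \<open>auto intro!: has_derivative_snd has_derivative_ident simp: has_field_derivative_def\<close>)
  then show ?thesis by simp
qed

lemma continuous_on_of_has_real_derivative:
  assumes "\<And>x. (f has_real_derivative f' x) (at x)"
  shows "continuous_on A f"
  using assms by (intro continuous_at_imp_continuous_on) (auto intro: DERIV_isCont)

lemma le_of_forall_le_add_mult:
  fixes A B C :: real
  assumes "\<And>\<eta>. \<eta> > 0 \<Longrightarrow> A \<le> B + \<eta> * C"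
  shows "A \<le> B"
proof -
  have "((\<lambda>\<eta>. B + \<eta> * C) \<longlongrightarrow> B + 0 * C) (at_right 0)"
    by (intro tendsto_intros)
  moreover have "\<forall>\<^sub>F \<eta> in at_right 0. A \<le> B + \<eta> * C"
    using assms by (auto simp: eventually_at_right_field intro!: exI[of _ 1])
  ultimately have "A \<le> B + 0 * C" by (rule tendsto_lowerbound) simp
  then show ?thesis by simp
qed

text \<open>
A particle at rest at \<open>x\<close> pays at most \<open>- k x\<close> per unit of time, since its Lagrangian is
\<open>sup p. - F x p\<close>.
\<close>

lemma subsol_wait:
  assumes sub: "evol_visc_subsol F u" and u: "continuous_on (UNIV \<times> {0..}) u"
    and k: "continuous_on UNIV k" "\<And>x p. k x \<le> F x p"
    and st: "0 \<le> s" "s \<le> t"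
  shows "u (x, t) \<le> u (x, s) - k x * (t - s)"
proof -
  have "u (x, t) \<le> u (x, s) + (2 * \<eta> - k x) * (t - s)" if \<eta>: "\<eta> > 0" for \<eta>
  proof -
    \<comment> \<open>One \<open>\<eta>\<close> pays for the variation of \<open>k\<close> near \<open>x\<close>, the other makes the inequality strict.\<close>
    obtain \<rho> where \<rho>: "\<rho> > 0" "\<And>y. \<bar>y - x\<bar> < \<rho> \<Longrightarrow> \<bar>k y - k x\<bar> < \<eta>"
      using k(1) \<eta> unfolding continuous_on_iff dist_real_def by blast
    define Q where "Q = (\<lambda>z::real\<times>real. (2 * \<eta> - k x) * (snd z - s))"
    define g where "g = (\<lambda>z::real\<times>real. (fst z - x)\<^sup>2 + (max 0 (snd z - t))\<^sup>2)"
    have "C1_with_partials Q (\<lambda>_. 0) (\<lambda>_. 2 * \<eta> - k x) \<and> continuous_on UNIV Q"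
      unfolding Q_def by (rule C1_with_partialsI; (intro continuous_intros)?;
        auto intro!: derivative_eq_intros simp: case_prod_unfold)
    then have Q: "C1_with_partials Q (\<lambda>_. 0) (\<lambda>_. 2 * \<eta> - k x)" "continuous_on UNIV Q" by auto
    have d: "((\<lambda>\<tau>. (max 0 (\<tau> - t))\<^sup>2) has_real_derivative 2 * max 0 (\<tau> - t)) (at \<tau>)" for \<tau>
      using DERIV_shift[of "\<lambda>x. (max 0 x)\<^sup>2" "2 * max 0 (\<tau> - t)" \<tau> "- t"]
        positive_part_square_derivative[of "\<tau> - t"] by simp
    have "C1_with_partials g (\<lambda>z. 2 * (fst z - x)) (\<lambda>z. 2 * max 0 (snd z - t)) \<and> continuous_on UNIV g"
      unfolding g_def
    proof (rule C1_with_partialsI, goal_cases)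
      case (3 y \<tau>)
      show ?case
        by (rule has_derivative_eq_rhs, rule has_derivative_add, rule derivative_intros,
            (rule has_derivative_diff has_derivative_fst has_derivative_ident has_derivative_const)+,
            rule has_derivative_snd_compose[OF d])
          (auto simp: case_prod_unfold algebra_simps)
    qed (intro continuous_intros)+
    then have g: "C1_with_partials g (\<lambda>z. 2 * (fst z - x)) (\<lambda>z. 2 * max 0 (snd z - t))" "continuous_on UNIV g" by auto
    obtain y \<tau> where y: "y \<in> {x - \<rho>..x + \<rho>}" "\<tau> \<in> {s..t + 1}"
      "y = x - \<rho> \<or> y = x + \<rho> \<or> \<tau> = s \<or> \<tau> = t + 1" "g (y, \<tau>) = 0"
      "u (x,t) - Q (x,t) \<le> u (y,\<tau>) - Q (y,\<tau>)"
    proof (atomize_elim, rule subsol_penalised_maximum[OF sub _ Q g _ st(1)])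
      show "continuous_on ({x - \<rho>..x + \<rho>} \<times> {s..t + 1}) u"
        using u by (rule continuous_on_subset) (use st in auto)
      show "g z \<ge> 0" for z by (simp add: g_def)
      fix n :: nat and y \<tau> assume y: "x - \<rho> < y" "y < x + \<rho>"
      have "k y > k x - \<eta>" using \<rho>(2)[of y] y by linarith
      moreover have "k y \<le> F y (0 + real n * (2 * (y - x)))" by (rule k)
      moreover have "0 \<le> real n * (2 * max 0 (\<tau> - t))" by simp
      ultimately show "0 < 2 * \<eta> - k x + real n * (2 * max 0 (snd (y, \<tau>) - t)) +
          F y (0 + real n * (2 * (fst (y,\<tau>) - x)))" unfolding fst_conv snd_conv using \<eta> by linarith
    qed (use \<rho> st in \<open>auto simp: g_def\<close>)
    \<comment> \<open>The zeros of \<open>g\<close> form the line \<open>y = x\<close> up to time \<open>t\<close>, which meets the boundary only at time \<open>s\<close>.\<close>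
    from y(4) have "y = x" "\<tau> \<le> t" by (auto simp: g_def sum_power2_eq_zero_iff)
    with y(3) \<rho> have "\<tau> = s" by auto
    with y(5) \<open>y = x\<close> show ?thesis by (simp add: Q_def)
  qed
  then have "u (x, t) \<le> u (x, s) - k x * (t - s) + \<eta> * (2 * (t - s))" if "\<eta> > 0" for \<eta>
    using that by (force simp: algebra_simps)
  then show ?thesis by (rule le_of_forall_le_add_mult)
qed

section \<open>Hamiltonians described by their energy levels\<close>

text \<open>
\<open>G x e\<close> is the momentum of a particle of energy \<open>e\<close> at \<open>x\<close>, and \<open>D x e\<close>, the derivative of \<open>G\<close>
in \<open>e\<close>, is its slowness (time per unit of length).  The bounds on \<open>D\<close> and \<open>G\<close> are those of a
free particle, \<open>tangent\<close> is concavity in the energy, and the last assumption says that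
\<open>H x\<close> lies above its supporting line at the momentum \<open>G x e\<close>, whose slope is the velocity
\<open>1 / D x e\<close>.  Only positive energies occur, so \<open>H\<close> may be negative: this happens for
the oscillatory Hamiltonian, at low momenta.
\<close>

locale energy_profile =
  fixes H G D :: "real \<Rightarrow> real \<Rightarrow> real"
  assumes G_continuous: "\<And>e. e > 0 \<Longrightarrow> continuous_on UNIV (\<lambda>x. G x e)"
    and D_continuous: "continuous_on ({0<..} \<times> UNIV) (\<lambda>(e, x). D x e)"
    and D_pos: "\<And>x e. e > 0 \<Longrightarrow> D x e > 0"
    and D_le: "\<And>x e. e > 0 \<Longrightarrow> D x e \<le> 1 / sqrt (2 * e)"
    and G_ge: "\<And>x e. e > 0 \<Longrightarrow> sqrt (2 * e) \<le> G x e"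
    and tangent: "\<And>x e e'. e > 0 \<Longrightarrow> e' > 0 \<Longrightarrow> G x e' \<le> G x e + D x e * (e' - e)"
    and H_le: "\<And>x p e. e > 0 \<Longrightarrow> \<bar>p\<bar> \<le> G x e \<Longrightarrow> H x p \<le> e"
    and H_ge: "\<And>x p e. e > 0 \<Longrightarrow> D x e * e + \<bar>p\<bar> - G x e \<le> D x e * H x p"
begin

definition action :: "real \<Rightarrow> real \<Rightarrow> real \<Rightarrow> real" where
  "action e x y = \<bar>primitive (\<lambda>z. G z e) x - primitive (\<lambda>z. G z e) y\<bar>"

definition travel_time :: "real \<Rightarrow> real \<Rightarrow> real \<Rightarrow> real" where
  "travel_time e x y = \<bar>primitive (\<lambda>z. D z e) x - primitive (\<lambda>z. D z e) y\<bar>"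

lemma G_pos: "e > 0 \<Longrightarrow> G x e > 0"
  by (rule less_le_trans[OF _ G_ge]) auto

lemma D_continuous_x: "e > 0 \<Longrightarrow> continuous_on UNIV (\<lambda>x. D x e)"
proof -
  assume e: "e > 0"
  have "continuous_on UNIV (\<lambda>x. case (e, x) of (e, x) \<Rightarrow> D x e)"
    by (rule continuous_on_compose2[OF D_continuous]) (use e in \<open>auto intro!: continuous_intros\<close>)
  then show ?thesis by simp
qed

text \<open>
A particle of energy \<open>e\<close> arrives at \<open>z\<close> at time \<open>\<tau> z\<close>.  In the direction of motion its action
grows at the rate \<open>G - e * D\<close>, so \<open>Q\<close> below is the action plus the strictness term
\<open>\<eta>\<close>.  The supporting line of \<open>H\<close> at the momentum \<open>G\<close> is exactly what makes
\<open>Q\<close> plus any multiple of \<open>(t - \<tau> z)\<^sup>2\<close> a supersolution: the time derivative of the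
penalty cancels against its space derivative, however large the multiple is.
\<close>

lemma subsol_travel:
  assumes sub: "evol_visc_subsol H u" and u: "continuous_on (UNIV \<times> {0..}) u"
    and e: "e > 0" and t0: "t0 \<ge> 0"
  shows "u (x, t0 + travel_time e x y) \<le> u (y, t0) + action e x y - e * travel_time e x y"
proof (cases "x = y")
  case True
  then show ?thesis by (simp add: travel_time_def action_def)
next
  case False
  define S where "S = primitive (\<lambda>z. G z e)"
  define N where "N = primitive (\<lambda>z. D z e)"
  define \<sigma> :: real where "\<sigma> = sgn (x - y)"
  define \<tau> where "\<tau> = (\<lambda>z. t0 + \<sigma> * (N z - N y))"
  have \<sigma>: "\<sigma> = 1 \<and> y < x \<or> \<sigma> = -1 \<and> x < y" using False by (auto simp: \<sigma>_def sgn_if)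
  have S': "(S has_real_derivative G z e) (at z)" for z
    unfolding S_def by (rule primitive_derivative[OF G_continuous[OF e]])
  have N': "(N has_real_derivative D z e) (at z)" for z
    unfolding N_def by (rule primitive_derivative[OF D_continuous_x[OF e]])
  have Nm: "N z < N z'" if "z < z'" for z z'
    unfolding N_def by (rule primitive_strict_mono[OF D_continuous_x[OF e] D_pos[OF e] that])
  have Sm: "S z < S z'" if "z < z'" for z z'
    unfolding S_def by (rule primitive_strict_mono[OF G_continuous[OF e] G_pos[OF e] that])
  have tt: "travel_time e x y = \<sigma> * (N x - N y)"
    using \<sigma> Nm unfolding travel_time_def N_def[symmetric] by fastforce
  have ac: "action e x y = \<sigma> * (S x - S y)"
    using \<sigma> Sm unfolding action_def S_def[symmetric] by fastforce
  define l r where "l = min y (x + \<sigma>)" and "r = max y (x + \<sigma>)"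
  have \<tau>y: "\<tau> z > t0" if "z \<in> {l..r}" "z \<noteq> y" for z
    using \<sigma> that Nm[of y z] Nm[of z y] by (auto simp: \<tau>_def l_def r_def)
  have \<tau>le: "\<tau> z \<le> \<tau> (x + \<sigma>)" if "z \<in> {l..r}" for z
  proof (cases "z = x + \<sigma>")
    case False
    then show ?thesis using \<sigma> that Nm[of z "x + \<sigma>"] Nm[of "x + \<sigma>" z] by (auto simp: \<tau>_def l_def r_def)
  qed simp
  have "u (x, \<tau> x) \<le> u (y, t0) + action e x y - e * travel_time e x y + \<eta> * \<bar>x - y\<bar>" if \<eta>: "\<eta> > 0" for \<eta>
  proof -
    define Q where "Q = (\<lambda>z::real\<times>real. \<sigma> * (S (fst z) - S y) - e * \<sigma> * (N (fst z) - N y) + \<eta> * \<sigma> * (fst z - y))"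
    define g where "g = (\<lambda>z::real\<times>real. (max 0 (\<sigma> * (fst z - x)))\<^sup>2 + (snd z - \<tau> (fst z))\<^sup>2)"
    have d: "((\<lambda>z. (max 0 (\<sigma> * (z - x)))\<^sup>2) has_real_derivative 2 * max 0 (\<sigma> * (z - x)) * \<sigma>) (at z)" for z
      by (rule DERIV_chain2[of "\<lambda>z. (max 0 z)\<^sup>2" _ "\<lambda>z. \<sigma> * (z - x)"])
        (auto intro!: positive_part_square_derivative derivative_eq_intros)
    have \<tau>': "(\<tau> has_real_derivative \<sigma> * D z e) (at z)" for z
      unfolding \<tau>_def by (auto intro!: derivative_eq_intros N')
    have cG: "continuous_on A (\<lambda>z::real\<times>real. G (fst z) e)" and cD: "continuous_on A (\<lambda>z::real\<times>real. D (fst z) e)" for A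
      by (rule continuous_on_compose2[OF G_continuous[OF e]] continuous_on_compose2[OF D_continuous_x[OF e]];
        auto intro!: continuous_intros)+
    have c\<tau>: "continuous_on A (\<lambda>z::real\<times>real. \<tau> (fst z))" for A
      by (rule continuous_on_compose2[OF continuous_on_of_has_real_derivative[OF \<tau>', of UNIV]])
        (auto intro!: continuous_intros)
    have "C1_with_partials Q (\<lambda>z. \<sigma> * (G (fst z) e - e * D (fst z) e + \<eta>)) (\<lambda>_. 0) \<and> continuous_on UNIV Q"
      unfolding Q_def by (rule C1_with_partialsI; (intro continuous_intros cG cD)?;
        auto intro!: derivative_eq_intros has_derivative_fst_compose[OF S'] has_derivative_fst_compose[OF N']
          simp: case_prod_unfold algebra_simps)
    then have Q: "C1_with_partials Q (\<lambda>z. \<sigma> * (G (fst z) e - e * D (fst z) e + \<eta>)) (\<lambda>_. 0)" "continuous_on UNIV Q" by auto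
    have "C1_with_partials g (\<lambda>z. 2 * max 0 (\<sigma> * (fst z - x)) * \<sigma> - 2 * (snd z - \<tau> (fst z)) * (\<sigma> * D (fst z) e))
        (\<lambda>z. 2 * (snd z - \<tau> (fst z))) \<and> continuous_on UNIV g"
      unfolding g_def
    proof (rule C1_with_partialsI, goal_cases)
      case (3 z s)
      show ?case
        by (rule has_derivative_eq_rhs, rule has_derivative_add, rule has_derivative_fst_compose[OF d],
            rule derivative_intros, rule has_derivative_diff,
            (rule has_derivative_snd has_derivative_ident has_derivative_fst_compose[OF \<tau>'])+)
          (auto simp: case_prod_unfold algebra_simps)
    qed (intro continuous_intros cD c\<tau>)+
    then have g: "C1_with_partials g (\<lambda>z. 2 * max 0 (\<sigma> * (fst z - x)) * \<sigma> - 2 * (snd z - \<tau> (fst z)) * (\<sigma> * D (fst z) e))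
        (\<lambda>z. 2 * (snd z - \<tau> (fst z)))" "continuous_on UNIV g" by auto
    have xin: "x \<in> {l..r}" using \<sigma> by (auto simp: l_def r_def)
    have gx: "g (x, \<tau> x) = 0" by (simp add: g_def)
    have t0x: "t0 \<le> \<tau> x" using \<tau>y[OF xin False] by simp
    obtain z s where z: "z \<in> {l..r}" "s \<in> {t0..\<tau> (x + \<sigma>) + 1}"
      "z = l \<or> z = r \<or> s = t0 \<or> s = \<tau> (x + \<sigma>) + 1" "g (z, s) = 0"
      "u (x,\<tau> x) - Q (x,\<tau> x) \<le> u (z,s) - Q (z,s)"
    proof (atomize_elim, rule subsol_penalised_maximum[OF sub _ Q g _ t0 _ xin _ gx])
      show "continuous_on ({l..r} \<times> {t0..\<tau> (x + \<sigma>) + 1}) u"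
        using u by (rule continuous_on_subset) (use t0 in auto)
      show "g z \<ge> 0" for z by (simp add: g_def)
      show "\<tau> x \<in> {t0..\<tau> (x + \<sigma>) + 1}" using t0x \<tau>le[OF xin] by auto
      fix n :: nat and z s
      \<comment> \<open>\<open>R\<close> is the time derivative of the penalty; \<open>m\<close> is the part of the space derivative that has a sign.\<close>
      define R where "R = real n * (2 * (s - \<tau> z))"
      define m where "m = real n * (2 * max 0 (\<sigma> * (z - x)))"
      define p where "p = \<sigma> * (G z e - e * D z e + \<eta> + m - R * D z e)"
      have "m \<ge> 0" by (simp add: m_def)
      have "p * \<sigma> = G z e - e * D z e + \<eta> + m - R * D z e"
        unfolding p_def using \<sigma> by auto
      moreover have "p * \<sigma> \<le> \<bar>p\<bar>" using \<sigma> by auto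
      ultimately have "D z e * e + (G z e - e * D z e + \<eta> + m - R * D z e) - G z e \<le> D z e * H z p"
        using H_ge[OF e, of z p] by linarith
      then have "D z e * (R + H z p) \<ge> \<eta>" using \<open>m \<ge> 0\<close> by (simp add: algebra_simps)
      then have "R + H z p > 0" 
        using \<eta> by - (rule zero_less_mult_pos[OF _ D_pos[OF e, of z]], linarith)
      moreover have "p = \<sigma> * (G z e - e * D z e + \<eta>) + real n * (2 * max 0 (\<sigma> * (z - x)) * \<sigma>
          - 2 * (s - \<tau> z) * (\<sigma> * D z e))"
        by (simp add: p_def m_def R_def algebra_simps)
      ultimately show "0 < 0 + real n * (2 * (snd (z, s) - \<tau> (fst (z, s)))) +
          H z (\<sigma> * (G (fst (z, s)) e - e * D (fst (z, s)) e + \<eta>) + real n * (2 * max 0 (\<sigma> * (fst (z, s) - x)) * \<sigma>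
          - 2 * (snd (z, s) - \<tau> (fst (z, s))) * (\<sigma> * D (fst (z, s)) e)))"
        by (simp add: R_def)
    qed
    \<comment> \<open>The zeros of \<open>g\<close> form the trajectory up to \<open>x\<close>, which meets the boundary only at its starting point.\<close>
    from z(4) have s: "s = \<tau> z" "\<sigma> * (z - x) \<le> 0" by (auto simp: g_def sum_power2_eq_zero_iff)
    have "z = y"
    proof (rule ccontr)
      assume "z \<noteq> y"
      from \<tau>y[OF z(1) this] \<tau>le[OF z(1)] z(3) s(1) have "z = l \<or> z = r" by linarith
      with \<open>z \<noteq> y\<close> s(2) \<sigma> show False by (auto simp: l_def r_def min_def max_def split: if_splits)
    qed
    then have "u (x, \<tau> x) \<le> u (y, t0) + Q (x, \<tau> x)" using z(5) s by (simp add: Q_def \<tau>_def)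
    moreover have "Q (x, \<tau> x) = action e x y - e * travel_time e x y + \<eta> * \<bar>x - y\<bar>"
      using \<sigma> unfolding Q_def tt ac by auto
    ultimately show ?thesis by linarith
  qed
  then have "u (x, \<tau> x) \<le> u (y, t0) + action e x y - e * travel_time e x y"
    by (rule le_of_forall_le_add_mult)
  then show ?thesis unfolding tt \<tau>_def by simp
qed

section \<open>Lower bounds for supersolutions\<close>

lemma action_same: "action e x x = 0" by (simp add: action_def)

lemma action_ge:
  assumes e: "e > 0"
  shows "sqrt (2 * e) * \<bar>x - y\<bar> \<le> action e x y"
proof -
  let ?P = "primitive (\<lambda>z. G z e)"
  have *: "sqrt (2 * e) * (b - a) \<le> ?P b - ?P a" if "a \<le> b" for a b
  proof -
    have "?P a - sqrt (2 * e) * a \<le> ?P b - sqrt (2 * e) * b"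
      using that
    proof (rule DERIV_nonneg_imp_nondecreasing)
      fix z
      have "((\<lambda>z. ?P z - sqrt (2 * e) * z) has_real_derivative G z e - sqrt (2 * e)) (at z)"
        by (auto intro!: derivative_eq_intros primitive_derivative G_continuous e)
      then show "\<exists>d. ((\<lambda>z. ?P z - sqrt (2 * e) * z) has_real_derivative d) (at z) \<and> 0 \<le> d"
        using G_ge[OF e, of z] by force
    qed
    then show ?thesis by (simp add: algebra_simps)
  qed
  show ?thesis
    using *[of x y] *[of y x] by (cases "x \<le> y") (auto simp: action_def)
qed

lemma G_mono: "0 < e \<Longrightarrow> e \<le> e' \<Longrightarrow> G x e \<le> G x e'"
  using tangent[of e' e x] mult_nonneg_nonpos[of "D x e'" "e - e'"] D_pos[of e' x] by simp

lemma action_mono: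
  assumes e: "0 < e" "e \<le> e'"
  shows "action e x y \<le> action e' x y"
proof -
  have *: "primitive (\<lambda>z. G z e) b - primitive (\<lambda>z. G z e) a \<le> primitive (\<lambda>z. G z e') b - primitive (\<lambda>z. G z e') a"
    "primitive (\<lambda>z. G z e) a \<le> primitive (\<lambda>z. G z e) b" if "a \<le> b" for a b
  proof -
    have "primitive (\<lambda>z. G z e') a - primitive (\<lambda>z. G z e) a \<le> primitive (\<lambda>z. G z e') b - primitive (\<lambda>z. G z e) b"
      using that
    proof (rule DERIV_nonneg_imp_nondecreasing)
      fix z
      have "((\<lambda>z. primitive (\<lambda>z. G z e') z - primitive (\<lambda>z. G z e) z) has_real_derivative G z e' - G z e) (at z)"
        using e by (auto intro!: derivative_eq_intros primitive_derivative G_continuous)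
      then show "\<exists>d. ((\<lambda>z. primitive (\<lambda>z. G z e') z - primitive (\<lambda>z. G z e) z) has_real_derivative d) (at z) \<and> 0 \<le> d"
        using G_mono[OF e, of z] by force
    qed
    then show "primitive (\<lambda>z. G z e) b - primitive (\<lambda>z. G z e) a \<le> primitive (\<lambda>z. G z e') b - primitive (\<lambda>z. G z e') a"
      by linarith
    show "primitive (\<lambda>z. G z e) a \<le> primitive (\<lambda>z. G z e) b"
      using primitive_strict_mono[OF G_continuous[OF e(1)] G_pos[OF e(1)], of a b] that
      by (cases "a = b") auto
  qed
  show ?thesis
    using *[of x y] *[of y x] by (cases "x \<le> y") (auto simp: action_def)
qed

text \<open>
The test function is a soft maximum of the classical solutions
\<open>\<sigma> * (S e y - S e x) - e * (t - s)\<close> with \<open>e \<in> E\<close> and \<open>\<sigma> \<in> {1, -1}\<close>; its gradient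
is a convex combination of theirs.  Concavity of \<open>G\<close> in the energy bounds the mean momentum by the
momentum at the mean energy, so \<open>H\<close> is at most the mean energy there, which is the time derivative.
A maximum itself would not do: its kinks are of the kind that a supersolution does
not detect.  The term \<open>\<eta> * s\<close> makes the inequality strict, and growth of the action keeps
the minimum in a bounded region.
\<close>

lemma supersol_lower_bound:
  assumes super: "evol_visc_supersol H v" and v: "continuous_on (UNIV \<times> {0..}) v"
    and bdd: "bounded (v ` (UNIV \<times> {0..t + 1}))"
    and E: "finite E" "E \<noteq> {}" "\<And>e. e \<in> E \<Longrightarrow> e > 0"
    and t: "t \<ge> 0" and \<delta>: "\<delta> > 0"
  shows "\<exists>y. \<forall>e\<in>E. v (y, 0) + action e x y - e * t \<le> v (x, t) + \<delta>"
proof -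
  obtain e0 where e0: "e0 \<in> E" "e0 > 0" using E by blast
  obtain N where N: "\<And>z. z \<in> UNIV \<times> {0..t + 1} \<Longrightarrow> \<bar>v z\<bar> \<le> N"
    using bdd unfolding bounded_iff by auto
  define S where "S = (\<lambda>e. primitive (\<lambda>z. G z e))"
  have S': "(S e has_real_derivative G z e) (at z)" if "e \<in> E" for z e
    unfolding S_def by (rule primitive_derivative[OF G_continuous[OF E(3)[OF that]]])
  define I where "I = E \<times> {1, -1 :: real}"
  have I: "finite I" "I \<noteq> {}" using E by (auto simp: I_def)
  \<comment> \<open>The soft maximum with parameter \<open>\<kappa>\<close> exceeds the maximum by at most \<open>\<kappa> * ln (card I)\<close>.\<close>
  define \<kappa> where "\<kappa> = \<delta> / (2 * (ln (real (card I)) + 1))"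
  define \<eta> where "\<eta> = \<delta> / (2 * (t + 1))"
  have cI: "real (card I) \<ge> 1" using I by (simp add: Suc_leI card_gt_0_iff)
  then have lnI: "ln (real (card I)) \<ge> 0" by simp
  have \<kappa>: "\<kappa> > 0" and \<eta>: "\<eta> > 0" using \<delta> lnI t by (auto simp: \<kappa>_def \<eta>_def intro!: divide_pos_pos)
  have "\<kappa> * ln (real (card I)) \<le> \<kappa> * (ln (real (card I)) + 1)" "\<eta> * t \<le> \<eta> * (t + 1)"
    using \<kappa> \<eta> by auto
  moreover have "\<kappa> * (ln (real (card I)) + 1) = \<delta> / 2" "\<eta> * (t + 1) = \<delta> / 2"
    using lnI t by (auto simp: \<kappa>_def \<eta>_def field_simps)
  ultimately have small: "\<kappa> * ln (real (card I)) + \<eta> * t \<le> \<delta>" by linarith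
  define h where "h = (\<lambda>(e,\<sigma>) z. exp ((\<sigma> * (S e (fst z) - S e x) - e * (t - snd z)) / \<kappa>))"
  define Z where "Z = (\<lambda>z. \<Sum>i\<in>I. h i z)"
  have hpos: "h i z > 0" for i z by (simp add: h_def case_prod_unfold)
  have Zpos: "Z z > 0" for z unfolding Z_def using I hpos by (intro sum_pos) auto
  have hd: "(h i has_derivative (\<lambda>k. h i z * ((snd i * G (fst z) (fst i) * fst k + fst i * snd k) / \<kappa>))) (at z)"
    if "i \<in> I" for i z
  proof -
    have "fst i \<in> E" using that by (auto simp: I_def)
    note 1 = has_derivative_fst_compose[OF S'[OF this]]
    show ?thesis unfolding h_def case_prod_unfold
      by (rule has_derivative_eq_rhs, (rule derivative_intros 1)+)
        (use \<kappa> in \<open>auto simp: algebra_simps fun_eq_iff add_divide_distrib diff_divide_distrib\<close>)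
  qed
  have Zd: "(Z has_derivative (\<lambda>k. \<Sum>i\<in>I. h i z * ((snd i * G (fst z) (fst i) * fst k + fst i * snd k) / \<kappa>))) (at z)" for z
    unfolding Z_def by (intro has_derivative_sum hd)
  have cG: "continuous_on UNIV (\<lambda>z::real\<times>real. G (fst z) (fst i))" if "i \<in> I" for i
    using that E(3) by (intro continuous_on_compose2[OF G_continuous[of "fst i"]])
      (auto intro!: continuous_intros simp: I_def)
  have ch: "continuous_on UNIV (h i)" if "i \<in> I" for i
    using hd[OF that] by (auto intro!: continuous_at_imp_continuous_on has_derivative_continuous)
  have cZ: "continuous_on UNIV Z" unfolding Z_def using ch by (intro continuous_intros)
  define w where "w = (\<lambda>i z. h i z / Z z)"
  have cw: "continuous_on UNIV (w i)" if "i \<in> I" for i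
    unfolding w_def using Zpos by (intro continuous_intros ch that cZ) (metis less_irrefl)
  have wpos: "w i z \<ge> 0" for i z using hpos[of i z] Zpos[of z] by (simp add: w_def)
  have wsum: "(\<Sum>i\<in>I. w i z) = 1" for z
  proof -
    have "(\<Sum>i\<in>I. w i z) = Z z / Z z"
      unfolding w_def sum_divide_distrib[symmetric] by (simp add: Z_def)
    then show ?thesis using Zpos[of z] by simp
  qed
  define Qx where "Qx = (\<lambda>z. \<Sum>i\<in>I. w i z * (snd i * G (fst z) (fst i)))"
  define Qt where "Qt = (\<lambda>z. (\<Sum>i\<in>I. w i z * fst i) + \<eta>)"
  define Q where "Q = (\<lambda>z. \<kappa> * ln (Z z) + \<eta> * snd z)"
  define g where "g = (\<lambda>z::real\<times>real. (max 0 (snd z - t))\<^sup>2)"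
  have Q: "C1_with_partials Q Qx Qt \<and> continuous_on UNIV Q"
  proof (rule C1_with_partialsI)
    show "continuous_on UNIV Qx" "continuous_on UNIV Qt"
      unfolding Qx_def Qt_def by (intro continuous_intros cw cG; assumption)+
    fix y s
    have "((\<lambda>z. ln (Z z)) has_derivative (\<lambda>k. (\<Sum>i\<in>I. h i (y,s) * ((snd i * G (fst (y,s)) (fst i) * fst k
        + fst i * snd k) / \<kappa>)) * inverse (Z (y,s)))) (at (y,s))"
      by (rule has_derivative_eq_rhs[OF has_derivative_ln[OF Zpos Zd]]) simp
    then have "(Q has_derivative (\<lambda>k. \<kappa> * ((\<Sum>i\<in>I. h i (y,s) * ((snd i * G (fst (y,s)) (fst i) * fst k
        + fst i * snd k) / \<kappa>)) * inverse (Z (y,s))) + \<eta> * snd k)) (at (y,s))"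
      unfolding Q_def by (auto intro!: derivative_intros)
    also have "(\<lambda>k. \<kappa> * ((\<Sum>i\<in>I. h i (y,s) * ((snd i * G (fst (y,s)) (fst i) * fst k
        + fst i * snd k) / \<kappa>)) * inverse (Z (y,s))) + \<eta> * snd k)
        = (\<lambda>k. (\<Sum>i\<in>I. w i (y,s) * (snd i * G y (fst i)) * fst k + w i (y,s) * fst i * snd k) + \<eta> * snd k)"
      unfolding w_def sum_distrib_left sum_distrib_right fun_eq_iff
      using \<kappa> Zpos[of "(y,s)"] by (auto intro!: sum.cong simp: field_simps)
    also have "\<dots> = (\<lambda>(a, b). Qx (y,s) * a + Qt (y,s) * b)"
      by (rule ext) (simp add: Qx_def Qt_def case_prod_unfold sum.distrib sum_distrib_right distrib_right)
    finally show "(Q has_derivative (\<lambda>(a, b). Qx (y,s) * a + Qt (y,s) * b)) (at (y,s))" .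
  qed
  have d: "((\<lambda>\<tau>. (max 0 (\<tau> - t))\<^sup>2) has_real_derivative 2 * max 0 (\<tau> - t)) (at \<tau>)" for \<tau>
    using DERIV_shift[of "\<lambda>x. (max 0 x)\<^sup>2" "2 * max 0 (\<tau> - t)" \<tau> "- t"]
      positive_part_square_derivative[of "\<tau> - t"] by simp
  have g: "C1_with_partials g (\<lambda>z. 0) (\<lambda>z. 2 * max 0 (snd z - t)) \<and> continuous_on UNIV g"
    unfolding g_def
  proof (rule C1_with_partialsI, goal_cases)
    case (3 y \<tau>)
    show ?case
      by (rule has_derivative_eq_rhs, rule has_derivative_snd_compose[OF d]) auto
  qed (intro continuous_intros)+
  have Q_ge: "action e y x - e * (t - s) + \<eta> * s \<le> Q (y, s)" if e: "e \<in> E" for e y s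
  proof -
    have 1: "\<sigma> * (S e y - S e x) - e * (t - s) \<le> \<kappa> * ln (Z (y, s))" if "\<sigma> \<in> {1,-1}" for \<sigma>
    proof -
      have "h (e,\<sigma>) (y,s) \<le> Z (y,s)"
        unfolding Z_def using e that I hpos by (intro member_le_sum) (auto simp: I_def less_imp_le)
      then have "ln (h (e,\<sigma>) (y,s)) \<le> ln (Z (y,s))" using hpos by (simp add: Zpos)
      then have "(\<sigma> * (S e y - S e x) - e * (t - s)) / \<kappa> \<le> ln (Z (y,s))" by (simp add: h_def)
      then show ?thesis using \<kappa> by (simp add: field_simps)
    qed
    show ?thesis using 1[of 1] 1[of "-1"] unfolding Q_def action_def S_def by (auto simp: abs_if)
  qed
  have Qxt: "Q (x, t) = \<kappa> * ln (real (card I)) + \<eta> * t"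
    by (simp add: Q_def Z_def h_def case_prod_unfold)
  \<comment> \<open>At distance \<open>X\<close> from \<open>x\<close> the action at energy \<open>e0\<close> exceeds the oscillation of \<open>v\<close>.\<close>
  define X where "X = (2 * N + e0 * (t + 1) + \<delta> + 1) / sqrt (2 * e0) + 1"
  have N0: "N \<ge> 0" using N[of "(0,0)"] t by auto
  have X: "sqrt (2 * e0) * X > 2 * N + e0 * t + \<delta>" "X > 0"
  proof -
    have s0: "sqrt (2 * e0) > 0" using e0 by simp
    have "sqrt (2 * e0) * X = 2 * N + e0 * (t + 1) + \<delta> + 1 + sqrt (2 * e0)"
      using s0 unfolding X_def by (simp add: field_simps)
    moreover have "e0 * (t + 1) = e0 * t + e0" by (simp add: algebra_simps)
    ultimately show "sqrt (2 * e0) * X > 2 * N + e0 * t + \<delta>" using s0 e0 by linarith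
    show "X > 0" unfolding X_def using N0 e0 t \<delta> s0
      by (intro add_nonneg_pos divide_nonneg_pos add_nonneg_nonneg) auto
  qed
  obtain y s where y: "y \<in> {x - X..x + X}" "s \<in> {0..t + 1}"
    "y = x - X \<or> y = x + X \<or> s = 0 \<or> s = t + 1" "g (y, s) = 0"
    "- v (x,t) - Q (x,t) \<le> - v (y,s) - Q (y,s)"
  proof (atomize_elim, rule subsol_penalised_maximum[OF supersol_imp_subsol_uminus[OF super] _
        Q[THEN conjunct1] Q[THEN conjunct2] g[THEN conjunct1] g[THEN conjunct2]])
    show "continuous_on ({x - X..x + X} \<times> {0..t + 1}) (\<lambda>z. - v z)"
      using v by (auto intro!: continuous_intros intro: continuous_on_subset)
    show "g z \<ge> 0" for z by (simp add: g_def)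
    fix n :: nat and y s :: real
    let ?z = "(y, s)"
    define e where "e = (\<Sum>i\<in>I. w i ?z * fst i)"
    have ei: "fst i > 0" if "i \<in> I" for i using that E(3) by (auto simp: I_def)
    have epos: "e > 0"
    proof -
      have "0 < w i ?z * fst i" if "i \<in> I" for i
        using ei[OF that] hpos[of i ?z] Zpos[of ?z] by (simp add: w_def)
      then show ?thesis unfolding e_def using I by (intro sum_pos) auto
    qed
    have "\<bar>Qx ?z\<bar> \<le> (\<Sum>i\<in>I. \<bar>w i ?z * (snd i * G y (fst i))\<bar>)"
      unfolding Qx_def by (simp add: sum_abs)
    also have "\<dots> = (\<Sum>i\<in>I. w i ?z * G y (fst i))"
    proof (rule sum.cong[OF refl])
      fix i assume "i \<in> I"
      then have "\<bar>snd i\<bar> = 1" by (auto simp: I_def)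
      then show "\<bar>w i ?z * (snd i * G y (fst i))\<bar> = w i ?z * G y (fst i)"
        using wpos[of i ?z] G_pos[OF ei[OF \<open>i \<in> I\<close>], of y] by (simp add: abs_mult)
    qed
    also have "\<dots> \<le> (\<Sum>i\<in>I. w i ?z * (G y e + D y e * (fst i - e)))"
      using wpos by (intro sum_mono mult_left_mono tangent epos ei)
    also have "\<dots> = (\<Sum>i\<in>I. w i ?z) * (G y e - D y e * e) + D y e * (\<Sum>i\<in>I. w i ?z * fst i)"
      unfolding sum_distrib_left sum_distrib_right sum.distrib[symmetric]
      by (intro sum.cong refl) (simp add: algebra_simps)
    also have "\<dots> = G y e" unfolding wsum e_def[symmetric] by (simp add: algebra_simps)
    finally have "H y (- Qx ?z) \<le> e" by (intro H_le epos) simp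
    moreover have "Qt ?z = e + \<eta>" by (simp add: Qt_def e_def)
    moreover have "real n * (2 * max 0 (s - t)) \<ge> 0" by simp
    ultimately show "0 < Qt ?z + real n * (2 * max 0 (snd ?z - t)) + - H y (- (Qx ?z + real n * 0))"
      unfolding snd_conv mult_zero_right add_0_right using \<eta> by linarith
  qed (use X t in \<open>auto simp: g_def\<close>)
  have st: "s \<le> t" using y(4) by (auto simp: g_def)
  have vb: "\<bar>v (x,t)\<bar> \<le> N" "\<bar>v (y,s)\<bar> \<le> N" using N t y(2) by auto
  have ub: "Q (y,s) \<le> v (x,t) - v (y,s) + \<delta>" using y(5) Qxt small by linarith
  have "y \<noteq> x - X \<and> y \<noteq> x + X"
  proof (rule ccontr)
    assume "\<not> ?thesis"
    then have "\<bar>y - x\<bar> = X" using X by auto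
    then have "sqrt (2 * e0) * X \<le> action e0 y x" using action_ge[OF e0(2), of y x] by simp
    moreover have "e0 * (t - s) \<le> e0 * t" using e0 y(2) by simp
    moreover have "\<eta> * s \<ge> 0" using \<eta> y(2) by simp
    ultimately show False using Q_ge[OF e0(1), of y s] ub vb X(1) by linarith
  qed
  with y(3) st have "s = 0" by auto
  have "v (y, 0) + action e x y - e * t \<le> v (x, t) + \<delta>" if "e \<in> E" for e
    using Q_ge[OF that, of y 0] ub \<open>s = 0\<close> by (simp add: action_def abs_minus_commute)
  then show ?thesis by blast
qed

section \<open>Comparison of solutions of two Hamiltonians\<close>

lemma travel_time_eq_integral:
  assumes e: "e > 0"
  shows "travel_time e x y = integral {min x y..max x y} (\<lambda>z. D z e)"
proof -
  have *: "\<bar>primitive (\<lambda>z. D z e) b - primitive (\<lambda>z. D z e) a\<bar> = integral {a..b} (\<lambda>z. D z e)" if "a \<le> b" for a b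
  proof -
    have "primitive (\<lambda>z. D z e) a \<le> primitive (\<lambda>z. D z e) b"
      using primitive_strict_mono[OF D_continuous_x[OF e] D_pos[OF e], of a b] that by (cases "a = b") auto
    then show ?thesis using primitive_diff[OF D_continuous_x[OF e] that] by simp
  qed
  show ?thesis
    using *[of x y] *[of y x] unfolding travel_time_def
    by (cases "x \<le> y") (auto simp: min_def max_def abs_minus_commute)
qed

lemma travel_time_continuous: "continuous_on {0<..} (\<lambda>e. travel_time e x y)"
proof -
  have "continuous_on {0<..} (\<lambda>e. integral (cbox (min x y) (max x y)) (\<lambda>z. D z e))"
    by (rule integral_continuous_on_param) (rule continuous_on_subset[OF D_continuous], auto)
  then show ?thesis by (subst continuous_on_cong[OF refl travel_time_eq_integral]) auto
qed

lemma travel_time_le: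
  assumes e: "e > 0"
  shows "travel_time e x y \<le> \<bar>x - y\<bar> / sqrt (2 * e)"
proof -
  have "integral {min x y..max x y} (\<lambda>z. D z e) \<le> integral {min x y..max x y} (\<lambda>z. 1 / sqrt (2 * e))"
    using D_le[OF e] D_continuous_x[OF e]
    by (intro integral_le integrable_continuous_real) (auto intro: continuous_on_subset)
  also have "\<dots> = \<bar>x - y\<bar> / sqrt (2 * e)"
    by (cases "x \<le> y") (auto simp: min_def max_def)
  finally show ?thesis using travel_time_eq_integral[OF e] by simp
qed

lemma travel_time_nonneg: "travel_time e x y \<ge> 0" by (simp add: travel_time_def)

text \<open>
The best energy is the one whose travel time from \<open>y\<close> to \<open>x\<close> is \<open>t\<close>.  It exists unless
particles of arbitrarily small energy arrive before time \<open>t\<close>; then one of negligible energy is used,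
and the rest of the time is spent waiting at the cost \<open>w\<close>.  The bound on \<open>e\<close>, which is the
energy of a free particle, permits the use of finitely many energies in the lower bound for
supersolutions.
\<close>

lemma subsol_upper_bound:
  assumes sub: "evol_visc_subsol H u" and u: "continuous_on (UNIV \<times> {0..}) u"
    and wait: "\<And>s. 0 \<le> s \<Longrightarrow> s \<le> t \<Longrightarrow> u (x, t) \<le> u (x, s) + w"
    and t: "t > 0" and K: "\<bar>x - y\<bar> \<le> K" and \<delta>: "\<delta> > 0"
  shows "\<exists>e. 0 < e \<and> e \<le> 1 + K\<^sup>2 / (2 * t\<^sup>2) \<and> u (x, t) \<le> u (y, 0) + action e x y - e * t + w + \<delta>"
proof -
  define e1 where "e1 = min 1 (\<delta> / t)"
  have e1: "e1 > 0" "e1 \<le> 1" "e1 * t \<le> \<delta>" using t \<delta> by (auto simp: e1_def min_def field_simps)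
  have travel: "u (x, travel_time e x y) \<le> u (y, 0) + action e x y - e * travel_time e x y" if "e > 0" for e
    using subsol_travel[OF sub u that order_refl, of x y] by simp
  have wn: "w \<ge> 0" using wait[of t] t by simp
  show ?thesis
  proof (cases "travel_time e1 x y \<le> t")
    case True
    have "u (x, t) \<le> u (x, travel_time e1 x y) + w" by (rule wait[OF travel_time_nonneg True])
    moreover have "e1 * travel_time e1 x y \<ge> 0" using e1 travel_time_nonneg by simp
    ultimately have "u (x, t) \<le> u (y, 0) + action e1 x y - e1 * t + w + \<delta>"
      using travel[OF e1(1)] e1(3) by linarith
    moreover have "e1 \<le> 1 + K\<^sup>2 / (2 * t\<^sup>2)" using e1(2) by (simp add: add_increasing2)
    ultimately show ?thesis using e1 by blast
  next
    case False
    define e2 where "e2 = max e1 (K\<^sup>2 / (2 * t\<^sup>2))"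
    have e2: "e1 \<le> e2" "e2 \<le> 1 + K\<^sup>2 / (2 * t\<^sup>2)" using e1 unfolding e2_def
      by (auto simp: max_def intro: order_trans[OF _ le_add_same_cancel1[THEN iffD2]])
    have "K \<ge> 0" using K by linarith
    have "sqrt (2 * e2) \<ge> sqrt ((K / t)\<^sup>2)"
      by (rule real_sqrt_le_mono) (auto simp: e2_def power_divide field_simps max_def)
    then have "sqrt (2 * e2) \<ge> K / t" using \<open>K \<ge> 0\<close> t by simp
    then have "K / sqrt (2 * e2) \<le> t" using t e1 e2 by (simp add: field_simps)
    moreover have "\<bar>x - y\<bar> / sqrt (2 * e2) \<le> K / sqrt (2 * e2)"
      using K e1 e2 by (intro divide_right_mono) auto
    ultimately have "travel_time e2 x y \<le> t" using travel_time_le[of e2 x y] e1 e2 by linarith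
    then obtain e where e: "e1 \<le> e" "e \<le> e2" "travel_time e x y = t"
      using IVT2'[of "\<lambda>e. travel_time e x y" e2 t e1] False e2 e1
        continuous_on_subset[OF travel_time_continuous, of "{e1..e2}" x y] by fastforce
    have "u (x, t) \<le> u (y, 0) + action e x y - e * t + w + \<delta>"
      using travel[of e] e e1 wn \<delta> by simp
    then show ?thesis using e e1 e2 by (intro exI[of _ e]) auto
  qed
qed

end

text \<open>
The energy \<open>(L + 1)\<^sup>2 / 2\<close> is that of a free particle of momentum \<open>L + 1\<close>, which beats the slope
\<open>L\<close> of the initial datum.
\<close>

lemma action_dominates_lipschitz_data:
  assumes L: "L-lipschitz_on UNIV u0" and "\<bar>y - x\<bar> > (L + 1)\<^sup>2 / 2 * t"
    and "(L + 1) * \<bar>y - x\<bar> \<le> A"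
  shows "u0 x \<le> u0 y + A - (L + 1)\<^sup>2 / 2 * (t::real)"
proof -
  have "\<bar>u0 x - u0 y\<bar> \<le> L * \<bar>y - x\<bar>"
    using lipschitz_onD[OF L, of x y] by (simp add: dist_real_def abs_minus_commute)
  moreover have "(L + 1) * \<bar>y - x\<bar> = L * \<bar>y - x\<bar> + \<bar>y - x\<bar>" by (simp add: algebra_simps)
  ultimately show ?thesis using assms(2,3) by linarith
qed

lemma subsol_le_supersol:
  assumes P1: "energy_profile H1 G1 D1" and P2: "energy_profile H2 G2 D2"
    and sub: "evol_visc_subsol H1 u" and u: "continuous_on (UNIV \<times> {0..}) u"
    and super: "evol_visc_supersol H2 v" and v: "continuous_on (UNIV \<times> {0..}) v"
    and bdd: "bounded (v ` (UNIV \<times> {0..t + 1}))"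
    and init: "\<And>x. u (x, 0) = u0 x" "\<And>x. v (x, 0) = u0 x"
    and L: "L-lipschitz_on UNIV u0"
    and t: "0 \<le> t" "t \<le> T"
    and wait: "\<And>s. 0 \<le> s \<Longrightarrow> s \<le> t \<Longrightarrow> u (x, t) \<le> u (x, s) + w"
    and c: "\<And>y e. \<bar>x - y\<bar> \<le> (L + 1)\<^sup>2 / 2 * T \<Longrightarrow> e > 0 \<Longrightarrow>
      energy_profile.action G1 e x y \<le> energy_profile.action G2 e x y + c"
  shows "u (x, t) \<le> v (x, t) + (c + w)"
proof -
  interpret A: energy_profile H1 G1 D1 by (rule P1)
  interpret B: energy_profile H2 G2 D2 by (rule P2)
  define K where "K = (L + 1)\<^sup>2 / 2 * T"
  have Kpos: "K \<ge> 0" using t by (simp add: K_def)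
  have Lpos: "L \<ge> 0" using L by (rule lipschitz_on_nonneg)
  have wn: "w \<ge> 0" using wait[of t] t by simp
  have cn: "c \<ge> 0" using c[of x 1] Kpos by (simp add: A.action_same B.action_same K_def)
  show ?thesis
  proof (cases "t = 0")
    case True
    then show ?thesis using init wn cn by simp
  next
    case False
    then have t0: "t > 0" using t by simp
    show ?thesis
    proof (rule field_le_epsilon)
      fix \<epsilon> :: real assume "\<epsilon> > 0"
      define \<delta> where "\<delta> = \<epsilon> / 3"
      have \<delta>: "\<delta> > 0" using \<open>\<epsilon> > 0\<close> by (simp add: \<delta>_def)
      define h where "h = \<delta> / t"
      have h: "h > 0" "h * t = \<delta>" using \<delta> t0 by (auto simp: h_def)
      \<comment> \<open>\<open>E\<close> is a grid of mesh \<open>h\<close> that covers all energies occurring in the upper bound, together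
      with the energy that excludes distant starting points.\<close>
      define eL where "eL = (L + 1)\<^sup>2 / 2"
      define em where "em = 1 + K\<^sup>2 / (2 * t\<^sup>2)"
      define n where "n = nat \<lceil>em / h\<rceil>"
      define E where "E = insert eL ((\<lambda>i. real i * h) ` {1..n})"
      have eL: "eL > 0" using Lpos by (simp add: eL_def)
      have E: "finite E" "E \<noteq> {}" "\<And>e. e \<in> E \<Longrightarrow> e > 0" using eL h by (auto simp: E_def)
      obtain y where y: "\<And>e. e \<in> E \<Longrightarrow> u0 y + B.action e x y - e * t \<le> v (x, t) + \<delta>"
        using B.supersol_lower_bound[OF super v bdd E t(1) \<delta>] init(2) by metis
      show "u (x, t) \<le> v (x, t) + (c + w) + \<epsilon>"
      proof (cases "\<bar>y - x\<bar> \<le> K")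
        case True
        then have xy: "\<bar>x - y\<bar> \<le> K" by (simp add: abs_minus_commute)
        obtain e where e: "e > 0" "e \<le> em" "u (x, t) \<le> u0 y + A.action e x y - e * t + w + \<delta>"
          using A.subsol_upper_bound[OF sub u wait t0 xy \<delta>] init(1) by (auto simp: em_def)
        \<comment> \<open>Rounding \<open>e\<close> up to the grid increases the action and costs at most \<open>h * t = \<delta>\<close>.\<close>
        define i where "i = nat \<lceil>e / h\<rceil>"
        have "e / h > 0" using e h by simp
        then have i: "real i \<ge> e / h" "real i < e / h + 1" "i \<ge> 1" unfolding i_def by linarith+
        have "e / h \<le> em / h" using e h by (simp add: divide_right_mono)
        then have "i \<le> n" unfolding i_def n_def by (intro nat_mono ceiling_mono)
        with i have iE: "real i * h \<in> E" by (auto simp: E_def)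
        have ie: "e \<le> real i * h" "real i * h \<le> e + h" using i h by (auto simp: field_simps)
        have "B.action e x y \<le> B.action (real i * h) x y" by (rule B.action_mono[OF e(1) ie(1)])
        moreover have "real i * h * t \<le> e * t + \<delta>"
          using mult_right_mono[OF ie(2) t(1)] h(2) by (simp add: algebra_simps)
        moreover have "A.action e x y \<le> B.action e x y + c" using c[of y e] xy e by (simp add: K_def)
        ultimately show ?thesis using y[OF iE] e(3) by (simp add: \<delta>_def)
      next
        case False
        \<comment> \<open>A distant starting point is no better than staying at \<open>x\<close>.\<close>
        have "sqrt (2 * eL) = L + 1" using Lpos by (simp add: eL_def)
        then have 1: "(L + 1) * \<bar>y - x\<bar> \<le> B.action eL x y"
          using B.action_ge[OF eL, of x y] by (simp add: abs_minus_commute)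
        have "(L + 1)\<^sup>2 / 2 * t \<le> K" unfolding K_def using t by (intro mult_left_mono) auto
        with False have "\<bar>y - x\<bar> > (L + 1)\<^sup>2 / 2 * t" by linarith
        from action_dominates_lipschitz_data[OF L this 1] y[of eL]
        have "u0 x \<le> v (x, t) + \<delta>" by (simp add: E_def eL_def)
        moreover have "u (x, t) \<le> u0 x + w" using wait[of 0] t init(1) by simp
        ultimately show ?thesis using cn \<open>\<epsilon> > 0\<close> by (simp add: \<delta>_def)
      qed
    qed
  qed
qed

section \<open>The oscillatory and the effective energy profile\<close>

lemma sqrt_tangent:
  fixes e e' k :: real
  assumes "0 < e + k" "0 \<le> e' + k"
  shows "sqrt (2 * (e' + k)) \<le> sqrt (2 * (e + k)) + 1 / sqrt (2 * (e + k)) * (e' - e)"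
proof -
  define X where "X = sqrt (2 * (e + k))"
  define Y where "Y = sqrt (2 * (e' + k))"
  have X: "X > 0" "X\<^sup>2 = 2 * (e + k)" and Y: "Y\<^sup>2 = 2 * (e' + k)"
    using assms by (auto simp: X_def Y_def)
  have "0 \<le> (X - Y)\<^sup>2" by simp
  then have "Y * X \<le> X\<^sup>2 + (e' - e)" using X Y by (simp add: power2_eq_square algebra_simps)
  then have "Y \<le> X + 1 / X * (e' - e)" using X by (simp add: field_simps power2_eq_square)
  then show ?thesis by (simp add: X_def Y_def)
qed

lemma mechanical_energy_profile:
  assumes k: "continuous_on UNIV k" "\<And>x. 0 \<le> k x"
  shows "energy_profile (\<lambda>x p. 1/2 * p\<^sup>2 - k x) (\<lambda>x e. sqrt (2 * (e + k x))) (\<lambda>x e. 1 / sqrt (2 * (e + k x)))"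
proof
  fix x e :: real assume e: "e > 0"
  have ek: "e + k x > 0" using e k(2)[of x] by linarith
  show "continuous_on UNIV (\<lambda>x. sqrt (2 * (e + k x)))" by (intro continuous_intros k)
  show "1 / sqrt (2 * (e + k x)) > 0" using ek by simp
  show "1 / sqrt (2 * (e + k x)) \<le> 1 / sqrt (2 * e)" using e k(2)[of x] ek by (simp add: field_simps)
  show "sqrt (2 * e) \<le> sqrt (2 * (e + k x))" using k(2)[of x] by simp
  show "sqrt (2 * (e' + k x)) \<le> sqrt (2 * (e + k x)) + 1 / sqrt (2 * (e + k x)) * (e' - e)" if "e' > 0" for e'
    by (rule sqrt_tangent) (use ek that k(2)[of x] in auto)
  fix p :: real
  define X where "X = sqrt (2 * (e + k x))"
  have X: "X > 0" "X\<^sup>2 = 2 * (e + k x)" using ek by (auto simp: X_def)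
  show "1/2 * p\<^sup>2 - k x \<le> e" if "\<bar>p\<bar> \<le> sqrt (2 * (e + k x))"
  proof -
    have "\<bar>p\<bar>\<^sup>2 \<le> X\<^sup>2" using that by (intro power_mono) (auto simp: X_def)
    then show ?thesis using X by simp
  qed
  have "0 \<le> (X - \<bar>p\<bar>)\<^sup>2" by simp
  then have "e + \<bar>p\<bar> * X - X\<^sup>2 \<le> 1/2 * p\<^sup>2 - k x" using X(2) by (simp add: power2_eq_square algebra_simps)
  then have "1 / X * (e + \<bar>p\<bar> * X - X\<^sup>2) \<le> 1 / X * (1/2 * p\<^sup>2 - k x)" using X(1) by (intro mult_left_mono) auto
  then have "1 / X * e + \<bar>p\<bar> - X \<le> 1 / X * (1/2 * p\<^sup>2 - k x)"
    using X(1) by (simp add: field_simps power2_eq_square)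
  then show "1 / sqrt (2 * (e + k x)) * e + \<bar>p\<bar> - sqrt (2 * (e + k x)) \<le>
      1 / sqrt (2 * (e + k x)) * (1/2 * p\<^sup>2 - k x)" by (simp add: X_def)
next
  have "continuous_on ({0<..} \<times> UNIV) (\<lambda>z. 1 / sqrt (2 * (fst z + k (snd z))))"
  proof (intro continuous_intros continuous_on_compose2[OF k(1)] ballI)
    fix z :: "real \<times> real" assume "z \<in> {0<..} \<times> UNIV"
    then show "sqrt (2 * (fst z + k (snd z))) \<noteq> 0" using k(2)[of "snd z"] by auto
  qed auto
  then show "continuous_on ({0<..} \<times> UNIV) (\<lambda>(e, x). 1 / sqrt (2 * (e + k x)))"
    by (simp add: case_prod_unfold)
qed

definition mean_momentum :: "(real \<Rightarrow> real) \<Rightarrow> (real \<Rightarrow> real) \<Rightarrow> real \<Rightarrow> real \<Rightarrow> real" where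
  "mean_momentum a b x e = integral {0..1} (\<lambda>s. sqrt (2 * (e - a x * b s)))"

definition mean_slowness :: "(real \<Rightarrow> real) \<Rightarrow> (real \<Rightarrow> real) \<Rightarrow> real \<Rightarrow> real \<Rightarrow> real" where
  "mean_slowness a b x e = integral {0..1} (\<lambda>s. 1 / sqrt (2 * (e - a x * b s)))"

locale separable_potential =
  fixes a b :: "real \<Rightarrow> real"
  assumes a: "continuous_on UNIV a" "\<And>x. a x > 0"
    and b: "continuous_on UNIV b" "\<And>y. b y \<le> 0" "\<And>y. b (y + 1) = b y"
begin

lemma ab: "a x * b y \<le> 0" using a(2)[of x] b(2)[of y] by (simp add: mult_nonneg_nonpos)

lemma continuous_momentum: "continuous_on A (\<lambda>s. sqrt (2 * (e - a x * b s)))"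
  by (intro continuous_intros continuous_on_subset[OF b(1)]) auto

lemma continuous_slowness:
  assumes "e > 0" shows "continuous_on A (\<lambda>s. 1 / sqrt (2 * (e - a x * b s)))"
proof (intro continuous_intros continuous_on_subset[OF b(1)] ballI)
  fix s show "sqrt (2 * (e - a x * b s)) \<noteq> 0" using ab[of x s] assms by auto
qed auto

lemma mean_momentum_tangent:
  assumes e: "e > 0" "e' \<ge> 0"
  shows "mean_momentum a b x e' \<le> mean_momentum a b x e + mean_slowness a b x e * (e' - e)"
proof -
  let ?f = "\<lambda>e s. sqrt (2 * (e - a x * b s))" and ?g = "\<lambda>s. 1 / sqrt (2 * (e - a x * b s))"
  have "integral {0..1} (?f e') \<le> integral {0..1} (\<lambda>s. ?f e s + ?g s * (e' - e))"
  proof (rule integral_le)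
    show "?f e' integrable_on {0..1}" by (intro integrable_continuous_real continuous_momentum)
    show "(\<lambda>s. ?f e s + ?g s * (e' - e)) integrable_on {0..1}"
      by (intro integrable_continuous_real continuous_on_add continuous_on_mult continuous_on_const
          continuous_momentum continuous_slowness e)
    fix s
    show "?f e' s \<le> ?f e s + ?g s * (e' - e)"
      using sqrt_tangent[of e "- (a x * b s)" e'] e ab[of x s] by simp
  qed
  also have "\<dots> = integral {0..1} (?f e) + integral {0..1} ?g * (e' - e)"
  proof -
    have "integral {0..1} (\<lambda>s. ?f e s + ?g s * (e' - e)) = integral {0..1} (?f e) + integral {0..1} (\<lambda>s. ?g s * (e' - e))"
      by (rule Henstock_Kurzweil_Integration.integral_add; intro integrable_continuous_real continuous_on_mult
          continuous_on_const continuous_momentum continuous_slowness e)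
    then show ?thesis by (simp only: integral_mult_left)
  qed
  finally show ?thesis by (simp add: mean_momentum_def mean_slowness_def)
qed

lemma mean_momentum_ge: "e \<ge> 0 \<Longrightarrow> sqrt (2 * e) \<le> mean_momentum a b x e"
proof -
  assume "e \<ge> 0"
  have "integral {0..1::real} (\<lambda>s. sqrt (2 * e)) \<le> mean_momentum a b x e"
    unfolding mean_momentum_def
    by (intro integral_le integrable_continuous_real continuous_momentum) (use ab in auto)
  then show ?thesis by simp
qed

lemma mean_slowness_le: "e > 0 \<Longrightarrow> mean_slowness a b x e \<le> 1 / sqrt (2 * e)"
proof -
  assume e: "e > 0"
  have "mean_slowness a b x e \<le> integral {0..1::real} (\<lambda>s. 1 / sqrt (2 * e))"
    unfolding mean_slowness_def
  proof (intro integral_le integrable_continuous_real continuous_slowness e)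
    fix s
    show "1 / sqrt (2 * (e - a x * b s)) \<le> 1 / sqrt (2 * e)"
      using ab[of x s] e by (intro divide_left_mono) auto
  qed auto
  then show ?thesis by simp
qed

lemma mean_slowness_pos: "e > 0 \<Longrightarrow> mean_slowness a b x e > 0"
proof -
  assume e: "e > 0"
  have c: "continuous_on UNIV (\<lambda>s. 1 / sqrt (2 * (e - a x * b s)))" by (rule continuous_slowness[OF e])
  have "1 / sqrt (2 * (e - a x * b s)) > 0" for s using ab[of x s] e by simp
  from primitive_strict_mono[OF c this zero_less_one] primitive_diff[OF c zero_le_one]
  show ?thesis by (simp add: mean_slowness_def)
qed

lemma continuous_mean_momentum: "continuous_on UNIV (\<lambda>(e, x). mean_momentum a b x e)"
proof -
  have "continuous_on (UNIV \<times> cbox 0 1) (\<lambda>(z, s). sqrt (2 * (fst z - a (snd z) * b s)))"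
    unfolding case_prod_unfold
    by (intro continuous_intros continuous_on_compose2[OF a(1)] continuous_on_compose2[OF b(1)]) auto
  then have "continuous_on (UNIV :: (real \<times> real) set)
      (\<lambda>z. integral (cbox 0 1) (\<lambda>s. sqrt (2 * (fst z - a (snd z) * b s))))"
    by (rule integral_continuous_on_param)
  then show ?thesis by (simp add: case_prod_unfold mean_momentum_def)
qed

lemma continuous_mean_slowness: "continuous_on ({0<..} \<times> UNIV) (\<lambda>(e, x). mean_slowness a b x e)"
proof -
  have "continuous_on (({0<..} \<times> UNIV) \<times> cbox 0 1) (\<lambda>(z, s). 1 / sqrt (2 * (fst z - a (snd z) * b s)))"
    unfolding case_prod_unfold
  proof (intro continuous_intros continuous_on_compose2[OF a(1)] continuous_on_compose2[OF b(1)] ballI)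
    fix z :: "(real \<times> real) \<times> real" assume "z \<in> ({0<..} \<times> UNIV) \<times> cbox 0 1"
    then show "sqrt (2 * (fst (fst z) - a (snd (fst z)) * b (snd z))) \<noteq> 0"
      using ab[of "snd (fst z)" "snd z"] by auto
  qed auto
  then have "continuous_on ({0<..} \<times> UNIV)
      (\<lambda>z. integral (cbox 0 1) (\<lambda>s. 1 / sqrt (2 * (fst z - a (snd z) * b s))))"
    by (rule integral_continuous_on_param)
  then show ?thesis by (simp add: case_prod_unfold mean_slowness_def)
qed

text \<open>
Positive values of \<open>H\<close> invert the mean momentum, which is strictly increasing in the energy;
the value 0 is taken on the whole interval of momenta below the mean at energy 0.
\<close>

lemma effective_energy_profile:
  assumes H: "\<And>x p. H x p \<ge> 0" "\<And>x p. \<bar>p\<bar> \<le> mean_momentum a b x (H x p)"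
    "\<And>x p. H x p > 0 \<Longrightarrow> \<bar>p\<bar> = mean_momentum a b x (H x p)"
  shows "energy_profile H (mean_momentum a b) (mean_slowness a b)"
proof
  fix x e :: real assume e: "e > 0"
  show "continuous_on UNIV (\<lambda>x. mean_momentum a b x e)"
    using continuous_on_compose2[OF continuous_mean_momentum, of UNIV "\<lambda>x. (e, x)"]
    by (simp add: continuous_intros)
  show "mean_slowness a b x e > 0" by (rule mean_slowness_pos[OF e])
  show "mean_slowness a b x e \<le> 1 / sqrt (2 * e)" by (rule mean_slowness_le[OF e])
  show "sqrt (2 * e) \<le> mean_momentum a b x e" using e by (intro mean_momentum_ge) auto
  show "mean_momentum a b x e' \<le> mean_momentum a b x e + mean_slowness a b x e * (e' - e)" if "e' > 0" for e'
    using e that by (intro mean_momentum_tangent) auto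
  show "H x p \<le> e" if p: "\<bar>p\<bar> \<le> mean_momentum a b x e" for p
  proof (rule ccontr)
    assume "\<not> H x p \<le> e"
    then have h: "H x p > 0" "e - H x p < 0" using e by auto
    have "mean_momentum a b x e < mean_momentum a b x (H x p)"
      using mean_momentum_tangent[OF h(1) less_imp_le[OF e], of x]
        mult_pos_neg[OF mean_slowness_pos[OF h(1), of x] h(2)] by linarith
    then show False using H(3)[OF h(1)] p by simp
  qed
  fix p
  show "mean_slowness a b x e * e + \<bar>p\<bar> - mean_momentum a b x e \<le> mean_slowness a b x e * H x p"
    using mean_momentum_tangent[OF e H(1), of x x p] H(2)[of p x] by (simp add: algebra_simps)
qed (rule continuous_mean_slowness)

end

text \<open>
The difference \<open>primitive f (c + 1) - primitive f c\<close> has derivative \<open>f (c + 1) - f c = 0\<close>.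
\<close>

lemma periodic_integral:
  assumes f: "continuous_on UNIV f" "\<And>y. f (y + 1) = f y"
  shows "integral {0..1} (\<lambda>s. f (c + s)) = integral {0..1} (f :: real \<Rightarrow> real)"
    and "primitive f (c + 1) = primitive f c + integral {0..1} f"
proof -
  have d: "((\<lambda>c. primitive f (c + 1) - primitive f c) has_real_derivative 0) (at c)" for c
  proof -
    have "((\<lambda>c. primitive f (c + 1)) has_real_derivative f (c + 1) * 1) (at c)"
      by (rule DERIV_chain2[OF primitive_derivative[OF f(1)]]) (auto intro!: derivative_eq_intros)
    then have "((\<lambda>c. primitive f (c + 1) - primitive f c) has_real_derivative f (c + 1) * 1 - f c) (at c)"
      by (intro DERIV_diff primitive_derivative f)
    then show ?thesis by (simp add: f)
  qed
  have "primitive f (c + 1) - primitive f c = primitive f (0 + 1) - primitive f 0"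
    using DERIV_isconst_all[OF allI[OF d]] by blast
  also have "\<dots> = integral {0..1} f" using primitive_diff[OF f(1), of 0 1] by simp
  finally show 1: "primitive f (c + 1) = primitive f c + integral {0..1} f" by simp
  have "((\<lambda>s. f (c + s)) has_integral (primitive f (c + 1) - primitive f (c + 0))) {0..1}"
  proof (rule fundamental_theorem_of_calculus)
    fix s
    have "((\<lambda>s. primitive f (c + s)) has_real_derivative f (c + s) * 1) (at s)"
      by (rule DERIV_chain2[OF primitive_derivative[OF f(1)]]) (auto intro!: derivative_eq_intros)
    then show "((\<lambda>s. primitive f (c + s)) has_vector_derivative f (c + s)) (at s within {0..1})"
      by (auto simp: has_real_derivative_iff_has_vector_derivative intro: has_vector_derivative_at_within)
  qed simp
  then show "integral {0..1} (\<lambda>s. f (c + s)) = integral {0..1} f" using 1 by (simp add: integral_unique)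
qed

section \<open>Averaging\<close>

text \<open>
The difference of the roots is \<open>2 * m * (p - q)\<close> divided by their sum, and the sum is at least
\<open>2 * sqrt (2 * \<alpha> * m)\<close>: the factor \<open>m\<close> makes the estimate survive the limit \<open>e \<rightarrow> 0\<close>, where the
square root itself is not Lipschitz.
\<close>

lemma sqrt_energy_lipschitz:
  fixes e p q m M \<alpha> :: real
  assumes "e > 0" "0 < \<alpha>" "\<alpha> \<le> p" "\<alpha> \<le> q" "0 \<le> m" "m \<le> M"
  shows "\<bar>sqrt (2 * (e + p * m)) - sqrt (2 * (e + q * m))\<bar> \<le> sqrt (M / (2 * \<alpha>)) * \<bar>p - q\<bar>"
proof (cases "m = 0")
  case False
  then have m: "m > 0" using assms by simp
  define X where "X = sqrt (2 * (e + p * m))"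
  define Y where "Y = sqrt (2 * (e + q * m))"
  have pm: "\<alpha> * m \<le> p * m" "\<alpha> * m \<le> q * m" "\<alpha> * m > 0" using assms m by (auto intro: mult_right_mono)
  have XY: "X\<^sup>2 - Y\<^sup>2 = 2 * m * (p - q)"
    using assms pm by (simp add: X_def Y_def algebra_simps)
  have ge: "X \<ge> sqrt (2 * \<alpha> * m)" "Y \<ge> sqrt (2 * \<alpha> * m)"
    using pm assms unfolding X_def Y_def by (auto intro!: real_sqrt_le_mono simp: algebra_simps)
  have pos: "sqrt (2 * \<alpha> * m) > 0" using assms m by simp
  have "\<bar>X - Y\<bar> * (X + Y) = \<bar>X\<^sup>2 - Y\<^sup>2\<bar>"
  proof -
    have "X + Y > 0" using ge pos by linarith
    then show ?thesis by (simp add: power2_eq_square square_diff_square_factored abs_mult)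
  qed
  also have "\<dots> = 2 * m * \<bar>p - q\<bar>" using XY m by (simp add: abs_mult)
  finally have "\<bar>X - Y\<bar> * (X + Y) = 2 * m * \<bar>p - q\<bar>" .
  moreover have "\<bar>X - Y\<bar> * (2 * sqrt (2 * \<alpha> * m)) \<le> \<bar>X - Y\<bar> * (X + Y)"
    using ge by (intro mult_left_mono) auto
  ultimately have "\<bar>X - Y\<bar> * sqrt (2 * \<alpha> * m) \<le> m * \<bar>p - q\<bar>" by simp
  then have "\<bar>X - Y\<bar> \<le> m / sqrt (2 * \<alpha> * m) * \<bar>p - q\<bar>" using pos by (simp add: field_simps)
  also have "m / sqrt (2 * \<alpha> * m) = sqrt (m / (2 * \<alpha>))"
    using m assms by (simp add: real_sqrt_mult real_sqrt_divide field_simps)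
  also have "\<dots> * \<bar>p - q\<bar> \<le> sqrt (M / (2 * \<alpha>)) * \<bar>p - q\<bar>"
    using assms by (intro mult_right_mono real_sqrt_le_mono divide_right_mono) auto
  finally show ?thesis by (simp add: X_def Y_def)
qed (use assms in simp)

context separable_potential
begin

text \<open>
By periodicity the mean over \<open>s\<close> may be taken at \<open>z / \<epsilon> + s = (z + \<epsilon> * s) / \<epsilon>\<close>, and after
exchanging the integrals it suffices to compare, for each \<open>s\<close>, the integral over \<open>{y..x}\<close> with its
translate by \<open>\<epsilon> * s\<close>.  Freezing the slow variable costs \<open>\<epsilon>\<close> times the Lipschitz constant,
and the two end strips cost at most \<open>\<epsilon> * sqrt (2 * A * M)\<close>, because the parts \<open>sqrt (2 * e)\<close>
of the integrands cancel.
\<close>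

lemma averaging_error:
  assumes M: "\<And>y. - M \<le> b y" and A: "\<And>x. a x \<le> A"
    and \<alpha>: "\<alpha> > 0" "\<And>z. z \<in> {-K-1..K+1} \<Longrightarrow> \<alpha> \<le> a z"
    and \<Lambda>: "\<And>z z'. z \<in> {-K-1..K+1} \<Longrightarrow> z' \<in> {-K-1..K+1} \<Longrightarrow> \<bar>a z - a z'\<bar> \<le> \<Lambda> * \<bar>z - z'\<bar>"
    and \<epsilon>: "0 < \<epsilon>" "\<epsilon> < 1" and e: "e > 0" and yx: "-K \<le> y" "y \<le> x" "x \<le> K"
  shows "\<bar>integral {y..x} (\<lambda>z. sqrt (2 * (e - a z * b (z / \<epsilon>)))) - integral {y..x} (\<lambda>z. mean_momentum a b z e)\<bar>
    \<le> \<epsilon> * (sqrt (M / (2 * \<alpha>)) * \<Lambda> * (x - y) + sqrt (2 * A * M))"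
proof -
  define f where "f = (\<lambda>z r. sqrt (2 * (e - a z * b r)))"
  define q where "q = (\<lambda>z. f z (z / \<epsilon>))"
  define I where "I = (\<lambda>s. integral {y..x} (\<lambda>z. f z (z / \<epsilon> + s)))"
  let ?c1 = "sqrt (M / (2 * \<alpha>)) * \<Lambda>" and ?c0 = "sqrt (2 * A * M)"
  have M0: "M \<ge> 0" using M[of 0] b(2)[of 0] by linarith
  have A0: "A \<ge> 0" using A[of 0] a(2)[of 0] by linarith
  have \<Lambda>0: "\<Lambda> \<ge> 0" using \<Lambda>[of "-K-1" "-K"] yx by auto
  have cf: "continuous_on S (\<lambda>z. f (g z) (h z))" if "continuous_on S g" "continuous_on S h" for S :: "'c::topological_space set" and g h
    unfolding f_def using that
    by (intro continuous_intros continuous_on_compose2[OF a(1)] continuous_on_compose2[OF b(1)]) auto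
  have cq: "continuous_on S q" for S
    unfolding q_def using \<epsilon> by (intro cf continuous_intros) auto
  have lo: "sqrt (2 * e) \<le> f z r" for z r using ab[of z r] by (simp add: f_def)
  have hi: "f z r \<le> sqrt (2 * e) + ?c0" for z r
  proof -
    have "a z * (- b r) \<le> A * M"
      using A[of z] M[of r] a(2)[of z] b(2)[of r] by (intro mult_mono) auto
    then have "f z r \<le> sqrt (2 * e + 2 * A * M)" unfolding f_def by (intro real_sqrt_le_mono) (simp add: algebra_simps)
    also have "\<dots> \<le> sqrt (2 * e) + ?c0" using e A0 M0 by (intro sqrt_add_le_add_sqrt) auto
    finally show ?thesis .
  qed
  have mean: "mean_momentum a b z e = integral {0..1} (\<lambda>s. f z (z / \<epsilon> + s))" for z
  proof -
    have "integral {0..1} (\<lambda>s. f z (z / \<epsilon> + s)) = integral {0..1} (f z)"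
    proof (rule periodic_integral(1))
      show "continuous_on UNIV (f z)" using cf[of UNIV "\<lambda>_. z" "\<lambda>r. r"] by (simp add: continuous_on_id)
    qed (simp add: f_def b(3))
    then show ?thesis unfolding mean_momentum_def by (simp add: f_def)
  qed
  have "integral {y..x} (\<lambda>z. mean_momentum a b z e) = integral {0..1} I"
  proof -
    have "continuous_on (cbox (y, 0) (x, 1)) (\<lambda>(z, s). f z (z / \<epsilon> + s))"
      unfolding case_prod_unfold using \<epsilon> by (intro cf continuous_intros) auto
    from integral_swap_continuous[OF this] show ?thesis unfolding mean I_def by simp
  qed
  moreover have "\<bar>integral {0..1} I - q0\<bar> \<le> B" if I: "\<And>s. s \<in> {0..1} \<Longrightarrow> \<bar>I s - q0\<bar> \<le> B" for q0 B
  proof -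
    have "continuous_on ({0..1} \<times> cbox y x) (\<lambda>(s, z). f z (z / \<epsilon> + s))"
      unfolding case_prod_unfold using \<epsilon> by (intro cf continuous_intros) auto
    then have "continuous_on {0..1} I"
      using integral_continuous_on_param[of "{0..1}" y x "\<lambda>s z. f z (z / \<epsilon> + s)"] by (simp add: I_def)
    then have i: "I integrable_on {0..1}" by (rule integrable_continuous_real)
    have "norm (integral {0..1} (\<lambda>s. I s - q0)) \<le> integral {0..1::real} (\<lambda>s. B)"
      using I i by (intro integral_norm_bound_integral integrable_diff) auto
    also have "integral {0..1} (\<lambda>s. I s - q0) = integral {0..1} I - q0"
      using i by (subst Henstock_Kurzweil_Integration.integral_diff) auto
    finally show ?thesis by simp
  qed
  moreover have "\<bar>I s - integral {y..x} q\<bar> \<le> \<epsilon> * (?c1 * (x - y) + ?c0)" if s: "s \<in> {0..1}" for s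
  proof -
    \<comment> \<open>The translation is by at most \<open>\<epsilon> < 1\<close>, which is why the bounds on \<open>a\<close> are needed on a
    neighbourhood of size 1.\<close>
    define d where "d = \<epsilon> * s"
    have d: "0 \<le> d" "d \<le> \<epsilon>" using \<epsilon> s by (auto simp: d_def mult_left_le)
    have ds: "z / \<epsilon> + s = (z + d) / \<epsilon>" for z using \<epsilon> by (simp add: d_def field_simps)
    have "((\<lambda>z. q (z + d)) has_integral (primitive q (x + d) - primitive q (y + d))) {y..x}"
    proof (rule fundamental_theorem_of_calculus[OF yx(2)])
      fix z
      have "((\<lambda>z. primitive q (z + d)) has_real_derivative q (z + d) * 1) (at z)"
        by (rule DERIV_chain2[OF primitive_derivative[OF cq]]) (auto intro!: derivative_eq_intros)
      then show "((\<lambda>z. primitive q (z + d)) has_vector_derivative q (z + d)) (at z within {y..x})"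
        by (auto simp: has_real_derivative_iff_has_vector_derivative intro: has_vector_derivative_at_within)
    qed
    then have J: "integral {y..x} (\<lambda>z. q (z + d)) = primitive q (x + d) - primitive q (y + d)" by (rule integral_unique)
    \<comment> \<open>Both end strips contribute between \<open>sqrt (2 * e) * d\<close> and this value plus the error.\<close>
    have strip: "sqrt (2 * e) * d \<le> primitive q (z + d) - primitive q z" "primitive q (z + d) - primitive q z \<le> (sqrt (2 * e) + ?c0) * d" for z
    proof -
      have "integral {z..z+d} (\<lambda>_. sqrt (2 * e)) \<le> integral {z..z+d} q"
        "integral {z..z+d} q \<le> integral {z..z+d} (\<lambda>_. sqrt (2 * e) + ?c0)"
        by (rule integral_le; (intro integrable_continuous_real cq continuous_on_const)?;
          simp add: q_def lo hi)+
      then show "sqrt (2 * e) * d \<le> primitive q (z + d) - primitive q z" "primitive q (z + d) - primitive q z \<le> (sqrt (2 * e) + ?c0) * d"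
        using primitive_diff[OF cq, of z "z + d"] d by (simp_all add: mult.commute)
    qed
    have "\<bar>integral {y..x} (\<lambda>z. q (z + d)) - integral {y..x} q\<bar> \<le> ?c0 * d"
      using strip[of x] strip[of y] primitive_diff[OF cq yx(2)] unfolding J by (simp add: algebra_simps abs_le_iff)
    also have "\<dots> \<le> ?c0 * \<epsilon>" using d A0 M0 by (intro mult_left_mono) auto
    finally have 1: "\<bar>integral {y..x} (\<lambda>z. q (z + d)) - integral {y..x} q\<bar> \<le> ?c0 * \<epsilon>" .
    have "norm (integral {y..x} (\<lambda>z. f z (z / \<epsilon> + s) - q (z + d))) \<le> integral {y..x} (\<lambda>z. ?c1 * \<epsilon>)"
    proof (rule integral_norm_bound_integral)
      have "continuous_on {y..x} (\<lambda>z. q (z + d))"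
        by (rule continuous_on_compose2[OF cq[of UNIV]]) (auto intro!: continuous_intros)
      then show "(\<lambda>z. f z (z / \<epsilon> + s) - q (z + d)) integrable_on {y..x}"
        using \<epsilon> by (intro integrable_continuous_real continuous_on_diff cf continuous_intros) auto
      fix z assume z: "z \<in> {y..x}"
      then have zz: "z \<in> {-K-1..K+1}" "z + d \<in> {-K-1..K+1}" using yx d \<epsilon> by auto
      define r where "r = (z + d) / \<epsilon>"
      have "norm (f z (z / \<epsilon> + s) - q (z + d)) = \<bar>sqrt (2 * (e + a z * (- b r))) - sqrt (2 * (e + a (z + d) * (- b r)))\<bar>"
        by (simp add: q_def ds f_def r_def)
      also have "\<dots> \<le> sqrt (M / (2 * \<alpha>)) * \<bar>a z - a (z + d)\<bar>"
        using M[of r] b(2)[of r] by (intro sqrt_energy_lipschitz e \<alpha> zz) auto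
      also have "\<dots> \<le> sqrt (M / (2 * \<alpha>)) * (\<Lambda> * \<epsilon>)"
      proof (intro mult_left_mono)
        have "\<bar>a z - a (z + d)\<bar> \<le> \<Lambda> * d" using \<Lambda>[OF zz] d by simp
        also have "\<dots> \<le> \<Lambda> * \<epsilon>" using d \<Lambda>0 by (intro mult_left_mono) auto
        finally show "\<bar>a z - a (z + d)\<bar> \<le> \<Lambda> * \<epsilon>" .
      qed (use M0 \<alpha> in auto)
      finally show "norm (f z (z / \<epsilon> + s) - q (z + d)) \<le> ?c1 * \<epsilon>" by (simp add: mult.assoc)
    qed auto
    also have "integral {y..x} (\<lambda>z. f z (z / \<epsilon> + s) - q (z + d)) = I s - integral {y..x} (\<lambda>z. q (z + d))"
      unfolding I_def
    proof (rule Henstock_Kurzweil_Integration.integral_diff; intro integrable_continuous_real)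
      show "continuous_on {y..x} (\<lambda>z. q (z + d))"
        by (rule continuous_on_compose2[OF cq[of UNIV]]) (auto intro!: continuous_intros)
      show "continuous_on {y..x} (\<lambda>z. f z (z / \<epsilon> + s))" using \<epsilon> by (intro cf continuous_intros) auto
    qed
    finally have "\<bar>I s - integral {y..x} (\<lambda>z. q (z + d))\<bar> \<le> ?c1 * \<epsilon> * (x - y)"
      using yx by (simp add: mult_ac)
    with 1 show ?thesis by (simp add: algebra_simps)
  qed
  ultimately have "\<bar>integral {y..x} (\<lambda>z. mean_momentum a b z e) - integral {y..x} q\<bar> \<le> \<epsilon> * (?c1 * (x - y) + ?c0)"
    by metis
  then show ?thesis by (simp add: q_def f_def abs_minus_commute)
qed

end

section \<open>The cell problem\<close>

lemma C1_imp_deriv: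
  assumes "\<phi> C1_differentiable_on UNIV"
  shows "(\<phi> has_real_derivative deriv \<phi> y) (at y)"
proof -
  obtain D where "\<And>x. (\<phi> has_vector_derivative D x) (at x)"
    using assms by (auto simp: C1_differentiable_on_def)
  then have "(\<phi> has_real_derivative D y) (at y)"
    by (simp add: has_real_derivative_iff_has_vector_derivative)
  then show ?thesis by (metis DERIV_imp_deriv)
qed

lemma C1_differentiable_onI:
  assumes "\<And>x. (\<phi> has_real_derivative \<phi>' x) (at x)" "continuous_on UNIV \<phi>'"
  shows "\<phi> C1_differentiable_on UNIV"
  using assms unfolding C1_differentiable_on_def
  by (auto simp: has_real_derivative_iff_has_vector_derivative)

lemma deriv_eq_of_touching_above:
  assumes \<phi>: "\<phi> C1_differentiable_on UNIV" and v: "(v has_real_derivative d) (at y)"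
    and ev: "\<forall>\<^sub>F z in nhds y. v z - \<phi> z \<le> v y - \<phi> (y::real)"
  shows "deriv \<phi> y = d"
proof -
  obtain r where r: "r > 0" "\<And>z. dist z y < r \<Longrightarrow> v z - \<phi> z \<le> v y - \<phi> y"
    using ev unfolding eventually_nhds_metric by blast
  have "((\<lambda>z. v z - \<phi> z) has_real_derivative d - deriv \<phi> y) (at y)"
    by (intro DERIV_diff v C1_imp_deriv \<phi>)
  then have "d - deriv \<phi> y = 0"
    by (rule DERIV_local_max[OF _ r(1)]) (use r(2) in \<open>auto simp: dist_real_def abs_minus_commute\<close>)
  then show ?thesis by simp
qed

lemma deriv_eq_of_touching_below:
  assumes \<phi>: "\<phi> C1_differentiable_on UNIV" and v: "(v has_real_derivative d) (at y)"
    and ev: "\<forall>\<^sub>F z in nhds y. v z - \<phi> z \<ge> v y - \<phi> (y::real)"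
  shows "deriv \<phi> y = d"
proof -
  obtain r where r: "r > 0" "\<And>z. dist z y < r \<Longrightarrow> v z - \<phi> z \<ge> v y - \<phi> y"
    using ev unfolding eventually_nhds_metric by blast
  have "((\<lambda>z. v z - \<phi> z) has_real_derivative d - deriv \<phi> y) (at y)"
    by (intro DERIV_diff v C1_imp_deriv \<phi>)
  then have "d - deriv \<phi> y = 0"
    by (rule DERIV_local_min[OF _ r(1)]) (use r(2) in \<open>auto simp: dist_real_def abs_minus_commute\<close>)
  then show ?thesis by simp
qed

lemma one_periodic_add_int:
  assumes "one_periodic f"
  shows "f (y + of_int n) = f y"
proof (induction n rule: int_induct[where k = 0])
  case (step1 i)
  then show ?case using assms unfolding one_periodic_def by (metis add.assoc of_int_1 of_int_add)
next
  case (step2 i)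
  have "f (y + of_int (i - 1) + 1) = f (y + of_int (i - 1))"
    using assms unfolding one_periodic_def by blast
  then show ?case using step2 by (simp add: algebra_simps)
qed simp

lemma one_periodic_bounded:
  assumes "one_periodic f" "continuous_on UNIV f"
  obtains N where "\<And>y. \<bar>f y\<bar> \<le> N"
proof -
  have "compact (f ` {0..1})"
    using assms(2) by (intro compact_continuous_image) (auto intro: continuous_on_subset)
  then obtain N where N: "\<And>y. y \<in> {0..1} \<Longrightarrow> \<bar>f y\<bar> \<le> N"
    using compact_imp_bounded[of "f ` {0..1}"] unfolding bounded_iff by (metis imageI real_norm_def)
  have "\<bar>f y\<bar> \<le> N" for y
  proof -
    have "f (frac y + of_int \<lfloor>y\<rfloor>) = f (frac y)" by (rule one_periodic_add_int[OF assms(1)])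
    moreover have "frac y \<in> {0..1}" using frac_ge_0[of y] frac_lt_1[of y] by auto
    ultimately show ?thesis using N[of "frac y"] by (simp add: frac_def)
  qed
  then show thesis by (rule that)
qed

text \<open>
Doubling of variables.  At a maximum of \<open>v1 y - v2 z - \<kappa> * (y - z)\<^sup>2\<close> both test functions have
the same slope, so the kinetic terms cancel and only the difference of the potentials at two nearby
points remains.  Simultaneous integer shifts make the maximum over a compact set global.
\<close>

lemma cell_constant_le:
  assumes a: "a x \<ge> 0" and b: "continuous_on UNIV b"
    and sol: "cell_solution (separable_ham a b C0) x p c1 v1" "cell_solution (separable_ham a b C0) x p c2 v2"
  shows "c2 \<le> c1"
proof (rule ccontr)
  assume "\<not> c2 \<le> c1"
  then have c: "c2 - c1 > 0" by simp
  have per: "one_periodic v1" "one_periodic v2" and cont: "continuous_on UNIV v1" "continuous_on UNIV v2"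
    and sub: "visc_subsol (\<lambda>y q. separable_ham a b C0 x y (p + q) - c1) v1"
    and super: "visc_supersol (\<lambda>y q. separable_ham a b C0 x y (p + q) - c2) v2"
    using sol by (auto simp: cell_solution_def)
  obtain N1 where N1: "\<And>y. \<bar>v1 y\<bar> \<le> N1" using one_periodic_bounded[OF per(1) cont(1)] by blast
  obtain N2 where N2: "\<And>y. \<bar>v2 y\<bar> \<le> N2" using one_periodic_bounded[OF per(2) cont(2)] by blast
  define N where "N = N1 + N2"
  have N: "v1 y - v2 z \<le> N" "- N \<le> v1 y - v2 z" for y z
    using N1[of y] N2[of z] unfolding N_def by linarith+
  have N0: "N \<ge> 0" using N[of 0 0] by linarith
  have "uniformly_continuous_on {-1..2} (\<lambda>y. a x * b y)"
    by (rule compact_uniformly_continuous) (auto intro!: continuous_intros continuous_on_subset[OF b])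
  then obtain \<rho> where \<rho>: "\<rho> > 0" "\<And>y z. y \<in> {-1..2} \<Longrightarrow> z \<in> {-1..2} \<Longrightarrow> \<bar>y - z\<bar> < \<rho> \<Longrightarrow>
      \<bar>a x * b y - a x * b z\<bar> < c2 - c1"
    using c unfolding uniformly_continuous_on_def dist_real_def by metis
  \<comment> \<open>The first two summands exclude \<open>\<bar>y - z\<bar> > 1\<close>, the last one forces \<open>\<bar>y - z\<bar> < \<rho>\<close> at the maximum.\<close>
  define \<kappa> where "\<kappa> = 2 * N + 1 + (2 * N + 1) / \<rho>\<^sup>2"
  have "(2 * N + 1) / \<rho>\<^sup>2 > 0" using N0 \<rho> by (intro divide_pos_pos) auto
  then have \<kappa>: "\<kappa> \<ge> 2 * N + 1" "\<kappa> > 0" using N0 by (auto simp: \<kappa>_def)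
  have \<kappa>\<rho>: "\<kappa> * \<rho>\<^sup>2 > 2 * N"
  proof -
    have "\<kappa> * \<rho>\<^sup>2 = (2 * N + 1) * \<rho>\<^sup>2 + (2 * N + 1)" 
    proof -
      have "(2 * N + 1) / \<rho>\<^sup>2 * \<rho>\<^sup>2 = 2 * N + 1" using \<rho>(1)
        by (intro nonzero_eq_divide_eq[THEN iffD1] refl) simp
      then show ?thesis unfolding \<kappa>_def by (simp only: distrib_right)
    qed
    moreover have "(2 * N + 1) * \<rho>\<^sup>2 \<ge> 0" using N0 by simp
    ultimately show ?thesis by linarith
  qed
  define \<Phi> where "\<Phi> = (\<lambda>(y, z). v1 y - v2 z - \<kappa> * (y - z)\<^sup>2)"
  have "continuous_on ({0..1} \<times> {-1..2}) \<Phi>"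
    unfolding \<Phi>_def case_prod_unfold
    by (intro continuous_intros continuous_on_compose2[OF cont(1)] continuous_on_compose2[OF cont(2)]) auto
  then obtain w where w: "w \<in> {0..1} \<times> {-1..2}" "\<And>w'. w' \<in> {0..1} \<times> {-1..2} \<Longrightarrow> \<Phi> w' \<le> \<Phi> w"
    using continuous_attains_sup[of "{0..1::real} \<times> {-1..2::real}" \<Phi>] compact_Times[OF compact_Icc compact_Icc]
    by (metis atLeastAtMost_iff empty_iff insert_iff mem_Sigma_iff order_refl zero_le_one neg_le_0_iff_le zero_le_numeral)
  obtain y0 z0 where yz: "w = (y0, z0)" by (cases w)
  have low: "- N \<le> \<Phi> (y0, z0)" using w(2)[of "(0,0)"] N[of 0 0] unfolding yz by (auto simp: \<Phi>_def)
  have global: "\<Phi> (y, z) \<le> \<Phi> (y0, z0)" for y z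
  proof (cases "\<bar>y - z\<bar> \<le> 1")
    case True
    have "v1 (y + of_int (- \<lfloor>y\<rfloor>)) = v1 y" "v2 (z + of_int (- \<lfloor>y\<rfloor>)) = v2 z"
      by (rule one_periodic_add_int[OF per(1)] one_periodic_add_int[OF per(2)])+
    then have "\<Phi> (y, z) = \<Phi> (y - of_int \<lfloor>y\<rfloor>, z - of_int \<lfloor>y\<rfloor>)" by (simp add: \<Phi>_def)
    moreover have "(y - of_int \<lfloor>y\<rfloor>, z - of_int \<lfloor>y\<rfloor>) \<in> {0..1} \<times> {-1..2}"
      using True by auto linarith+
    ultimately show ?thesis using w(2) yz by simp
  next
    case False
    then have "1\<^sup>2 \<le> \<bar>y - z\<bar>\<^sup>2" by (intro power_mono) auto
    then have "\<kappa> * 1 \<le> \<kappa> * (y - z)\<^sup>2" using \<kappa> by (intro mult_left_mono) auto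
    then show ?thesis using N[of y z] \<kappa> low unfolding \<Phi>_def case_prod_conv by linarith
  qed
  have "\<kappa> * (y0 - z0)\<^sup>2 \<le> 2 * N" using low N[of y0 z0] by (simp add: \<Phi>_def)
  with \<kappa>\<rho> have "\<kappa> * (y0 - z0)\<^sup>2 < \<kappa> * \<rho>\<^sup>2" by linarith
  then have "\<bar>y0 - z0\<bar>\<^sup>2 < \<rho>\<^sup>2" using \<kappa>(2) by simp
  then have "\<bar>y0 - z0\<bar> < \<rho>" by (rule power2_less_imp_less) (use \<rho> in simp)
  then have osc: "\<bar>a x * b y0 - a x * b z0\<bar> < c2 - c1" using w(1) yz \<rho>(2) by auto
  let ?q = "2 * \<kappa> * (y0 - z0)"
  have d1: "((\<lambda>y. \<kappa> * (y - z0)\<^sup>2) has_real_derivative 2 * \<kappa> * (y - z0)) (at y)" for y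
    by (auto intro!: derivative_eq_intros)
  have d2: "((\<lambda>z. - \<kappa> * (y0 - z)\<^sup>2) has_real_derivative 2 * \<kappa> * (y0 - z)) (at z)" for z
    by (auto intro!: derivative_eq_intros simp: algebra_simps)
  have C1: "(\<lambda>y. \<kappa> * (y - z0)\<^sup>2) C1_differentiable_on UNIV"
    by (rule C1_differentiable_onI[OF d1]) (intro continuous_intros)
  have C2: "(\<lambda>z. - \<kappa> * (y0 - z)\<^sup>2) C1_differentiable_on UNIV"
    by (rule C1_differentiable_onI[OF d2]) (intro continuous_intros)
  have "separable_ham a b C0 x y0 (p + deriv (\<lambda>y. \<kappa> * (y - z0)\<^sup>2) y0) - c1 \<le> 0"
  proof (rule sub[unfolded visc_subsol_def, rule_format, OF conjI[OF C1 always_eventually]], rule allI)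
    fix y show "v1 y - \<kappa> * (y - z0)\<^sup>2 \<le> v1 y0 - \<kappa> * (y0 - z0)\<^sup>2"
      using global[of y z0] by (simp add: \<Phi>_def)
  qed
  moreover have "separable_ham a b C0 x z0 (p + deriv (\<lambda>z. - \<kappa> * (y0 - z)\<^sup>2) z0) - c2 \<ge> 0"
  proof (rule super[unfolded visc_supersol_def, rule_format, OF conjI[OF C2 always_eventually]], rule allI)
    fix z show "v2 z - - \<kappa> * (y0 - z)\<^sup>2 \<ge> v2 z0 - - \<kappa> * (y0 - z0)\<^sup>2"
      using global[of y0 z] by (simp add: \<Phi>_def)
  qed
  ultimately have "a x * b z0 - a x * b y0 \<ge> c2 - c1"
    unfolding DERIV_imp_deriv[OF d1] DERIV_imp_deriv[OF d2] separable_ham_def by linarith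
  then show False using osc by linarith
qed

lemma effective_ham_eq:
  assumes "a x \<ge> 0" "continuous_on UNIV b" "cell_solution (separable_ham a b C0) x p c v"
  shows "effective_ham (separable_ham a b C0) x p = c"
  unfolding effective_ham_def
proof (rule the_equality)
  fix c' assume "\<exists>v. cell_solution (separable_ham a b C0) x p c' v"
  then obtain v' where "cell_solution (separable_ham a b C0) x p c' v'" ..
  then show "c' = c"
    using cell_constant_le[of a x b, OF assms(1,2)] assms(3) by (meson order_antisym)
qed (use assms in blast)

context separable_potential
begin

lemma mean_momentum_period:
  "primitive (\<lambda>s. sqrt (2 * (e - a x * b s))) (y + 1) = primitive (\<lambda>s. sqrt (2 * (e - a x * b s))) y + mean_momentum a b x e"
  unfolding mean_momentum_def by (rule periodic_integral(2)[OF continuous_momentum]) (simp add: b)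

text \<open>
For large slopes the corrector is smooth: its total derivative is \<open>\<plusminus>sqrt (2 * (h - a x * b y))\<close>,
with the mean \<open>p\<close>.
\<close>

lemma cell_solution_rotation:
  assumes h: "h \<ge> 0" "\<bar>p\<bar> = mean_momentum a b x h"
  shows "\<exists>v. cell_solution (separable_ham a b C0) x p (h + C0) v"
proof -
  define g where "g = (\<lambda>s. sqrt (2 * (h - a x * b s)))"
  define \<sigma> :: real where "\<sigma> = (if p \<ge> 0 then 1 else -1)"
  have \<sigma>: "\<sigma> * \<bar>p\<bar> = p" "\<sigma> * \<sigma> = 1" by (auto simp: \<sigma>_def)
  have cg: "continuous_on UNIV g" unfolding g_def by (rule continuous_momentum)
  have g2: "g y * g y = 2 * (h - a x * b y)" for y
    using ab[of x y] h by (simp add: g_def)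
  define v where "v = (\<lambda>y. \<sigma> * primitive g y - p * y)"
  have v': "(v has_real_derivative \<sigma> * g y - p) (at y)" for y
    unfolding v_def by (auto intro!: derivative_eq_intros primitive_derivative[OF cg])
  have H: "separable_ham a b C0 x y (p + (\<sigma> * g y - p)) - (h + C0) = 0" for y
  proof -
    have "(\<sigma> * g y)\<^sup>2 = (\<sigma> * \<sigma>) * (g y * g y)" by (simp add: power2_eq_square)
    then show ?thesis using \<sigma> g2[of y] by (simp add: separable_ham_def field_simps)
  qed
  have "one_periodic v"
    unfolding one_periodic_def v_def g_def mean_momentum_period h(2)[symmetric]
    using \<sigma>(1) by (simp add: algebra_simps)
  moreover have "continuous_on UNIV v"
    using v' by (rule continuous_on_of_has_real_derivative)
  moreover have "visc_subsol (\<lambda>y q. separable_ham a b C0 x y (p + q) - (h + C0)) v"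
    unfolding visc_subsol_def
  proof (intro allI impI, elim conjE)
    fix \<phi> y assume "\<phi> C1_differentiable_on UNIV" "\<forall>\<^sub>F z in nhds y. v z - \<phi> z \<le> v y - \<phi> y"
    from deriv_eq_of_touching_above[OF this(1) v' this(2)]
    show "separable_ham a b C0 x y (p + deriv \<phi> y) - (h + C0) \<le> 0" using H by simp
  qed
  moreover have "visc_supersol (\<lambda>y q. separable_ham a b C0 x y (p + q) - (h + C0)) v"
    unfolding visc_supersol_def
  proof (intro allI impI, elim conjE)
    fix \<phi> y assume "\<phi> C1_differentiable_on UNIV" "\<forall>\<^sub>F z in nhds y. v z - \<phi> z \<ge> v y - \<phi> y"
    from deriv_eq_of_touching_below[OF this(1) v' this(2)]
    show "separable_ham a b C0 x y (p + deriv \<phi> y) - (h + C0) \<ge> 0" using H by simp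
  qed
  ultimately show ?thesis unfolding cell_solution_def by blast
qed

text \<open>
For small slopes the corrector is glued from solutions of the equation at level 0.  With \<open>S\<close> the
distance function of that equation measured from the zero \<open>y0\<close> of \<open>b\<close>, each
\<open>W m y = m * p + \<bar>S y - m * P\<bar>\<close> is the cone with vertex \<open>y0 + m\<close>, and \<open>w\<close> is their minimum; it is
attained since \<open>\<bar>p\<bar> < P\<close>.  As a minimum of functions that are 1-Lipschitz with respect to \<open>S\<close>, it is a
subsolution.  A test function touching it from below touches the cone attaining the minimum, which
solves the equation away from the vertex, and at the vertex level the potential vanishes.
\<close>

lemma cell_solution_flat:
  assumes y0: "b y0 = 0" and p: "\<bar>p\<bar> < mean_momentum a b x 0"
  shows "\<exists>v. cell_solution (separable_ham a b C0) x p (0 + C0) v"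
proof -
  define g where "g = (\<lambda>s. sqrt (2 * (0 - a x * b s)))"
  define S where "S = (\<lambda>y. primitive g y - primitive g y0)"
  define P where "P = mean_momentum a b x 0"
  define W where "W = (\<lambda>(n::int) y. of_int n * p + \<bar>S y - of_int n * P\<bar>)"
  have cg: "continuous_on UNIV g" unfolding g_def by (rule continuous_momentum)
  have gn: "g y \<ge> 0" for y unfolding g_def using ab[of x y] by simp
  have g2: "g y * g y = - (2 * (a x * b y))" for y using ab[of x y] by (simp add: g_def)
  have S': "(S has_real_derivative g y) (at y)" for y
    unfolding S_def by (auto intro!: derivative_eq_intros primitive_derivative[OF cg])
  have S_mono: "S y \<le> S z" if "y \<le> z" for y z
    using that by (rule DERIV_nonneg_imp_nondecreasing) (use S' gn in blast)
  have S1: "S (y + 1) = S y + P" for y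
    unfolding S_def P_def g_def by (simp only: mean_momentum_period)
  have Sint: "S (y0 + of_int n) = of_int n * P" for n
  proof -
    have "one_periodic (\<lambda>y. S y - y * P)" unfolding one_periodic_def S1 by (simp add: algebra_simps)
    from one_periodic_add_int[OF this, of y0 n] show ?thesis by (simp add: S_def algebra_simps)
  qed
  have "\<exists>n. \<forall>m. W n y \<le> W m y" for y
  proof -
    define B where "B = 2 * \<bar>S y\<bar> / (P - \<bar>p\<bar>)"
    \<comment> \<open>Vertices outside a bounded range lose against the vertex with index 0.\<close>
    have far: "W 0 y \<le> W n y" if "\<bar>of_int n\<bar> > B" for n
    proof -
      have "P \<ge> 0" "P - \<bar>p\<bar> > 0" using p by (auto simp: P_def)
      then have "\<bar>of_int n\<bar> * (P - \<bar>p\<bar>) > 2 * \<bar>S y\<bar>" using that by (simp add: B_def field_simps)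
      moreover have "\<bar>of_int n * p\<bar> = \<bar>of_int n\<bar> * \<bar>p\<bar>" "\<bar>of_int n * P\<bar> = \<bar>of_int n\<bar> * P"
        using \<open>P \<ge> 0\<close> by (simp_all add: abs_mult)
      ultimately show ?thesis unfolding W_def by (simp add: algebra_simps) linarith
    qed
    define F where "F = {n::int. \<bar>n\<bar> \<le> \<lceil>\<bar>B\<bar>\<rceil>}"
    have "F = {- \<lceil>\<bar>B\<bar>\<rceil>..\<lceil>\<bar>B\<bar>\<rceil>}" unfolding F_def by auto
    then have F: "finite F" "0 \<in> F" unfolding F_def by auto
    then obtain n where n: "n \<in> F" "\<And>m. m \<in> F \<Longrightarrow> W n y \<le> W m y"
      using ex_min_if_finite[of "(\<lambda>n. W n y) ` F"] by (metis (no_types, lifting) arg_min_if_finite(1)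
          arg_min_least empty_iff)
    have "W n y \<le> W m y" for m
    proof (cases "m \<in> F")
      case False
      then have "\<bar>of_int m\<bar> > B" unfolding F_def by simp linarith
      then show ?thesis using far[of m] n(2)[OF F(2)] by linarith
    qed (rule n(2))
    then show ?thesis by blast
  qed
  then obtain n where n: "\<And>y m. W (n y) y \<le> W m y" by metis
  define w where "w = (\<lambda>y. W (n y) y)"
  define v where "v = (\<lambda>y. w y - p * y)"
  have wL: "w y - w z \<le> \<bar>S y - S z\<bar>" for y z
  proof -
    have "w y \<le> W (n z) y" unfolding w_def by (rule n)
    also have "\<dots> \<le> w z + \<bar>S y - S z\<bar>" unfolding w_def W_def by linarith
    finally show ?thesis by linarith
  qed
  have W1: "W (m + 1) (y + 1) = p + W m y" for m y
    unfolding W_def S1 by (simp add: algebra_simps)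
  have w1: "w (y + 1) = w y + p" for y
  proof (rule antisym)
    show "w (y + 1) \<le> w y + p" using n[of "y + 1" "n y + 1"] by (simp add: w_def W1)
    show "w y + p \<le> w (y + 1)" using n[of y "n (y + 1) - 1"] W1[of "n (y + 1) - 1" y] by (simp add: w_def)
  qed
  have "one_periodic v" unfolding one_periodic_def v_def w1 by (simp add: algebra_simps)
  moreover have "continuous_on UNIV v"
  proof -
    have wabs: "\<bar>w y - w z\<bar> \<le> \<bar>S y - S z\<bar>" for y z
      using wL[of y z] wL[of z y] by (simp add: abs_le_iff abs_minus_commute)
    have "continuous_on UNIV S" using S' by (rule continuous_on_of_has_real_derivative)
    then have "continuous_on UNIV w"
      unfolding continuous_on_iff dist_real_def by (meson wabs order_le_less_trans)
    then show ?thesis unfolding v_def by (intro continuous_intros)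
  qed
  moreover have "visc_subsol (\<lambda>y q. separable_ham a b C0 x y (p + q) - (0 + C0)) v"
    unfolding visc_subsol_def
  proof (intro allI impI, elim conjE)
    fix \<phi> y assume \<phi>: "\<phi> C1_differentiable_on UNIV" and ev: "\<forall>\<^sub>F z in nhds y. v z - \<phi> z \<le> v y - \<phi> y"
    obtain r where r: "r > 0" "\<And>z. dist z y < r \<Longrightarrow> v z - \<phi> z \<le> v y - \<phi> y"
      using ev unfolding eventually_nhds_metric by blast
    define d where "d = p + deriv \<phi> y"
    have \<psi>: "- \<bar>S y - S z\<bar> \<le> (\<phi> z + p * z) - (\<phi> y + p * y)" if "\<bar>z - y\<bar> < r" for z
      using r(2)[of z] wL[of y z] that by (simp add: v_def dist_real_def)
    have d1: "((\<lambda>z. \<phi> z + p * z + S z) has_real_derivative d + g y) (at y)"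
      and d2: "((\<lambda>z. \<phi> z + p * z - S z) has_real_derivative d - g y) (at y)"
      unfolding d_def by (auto intro!: derivative_eq_intros S' C1_imp_deriv[OF \<phi>])
    \<comment> \<open>To the right of \<open>y\<close> the test function decreases no faster than \<open>S\<close> increases.\<close>
    have "d + g y \<ge> 0"
    proof (rule ccontr)
      assume "\<not> ?thesis"
      then obtain s where s: "s > 0" "\<And>h. h > 0 \<Longrightarrow> h < s \<Longrightarrow> \<phi> (y + h) + p * (y + h) + S (y + h) < \<phi> y + p * y + S y"
        using DERIV_neg_dec_right[OF d1] by auto
      define h where "h = min s r / 2"
      have h: "h > 0" "h < s" "h < r" using s r by (auto simp: h_def)
      show False using s(2)[OF h(1,2)] \<psi>[of "y + h"] S_mono[of y "y + h"] h by simp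
    qed
    moreover have "d - g y \<le> 0"
    proof (rule ccontr)
      assume "\<not> ?thesis"
      then obtain s where s: "s > 0" "\<And>h. h > 0 \<Longrightarrow> h < s \<Longrightarrow> \<phi> (y - h) + p * (y - h) - S (y - h) < \<phi> y + p * y - S y"
        using DERIV_pos_inc_left[OF d2] by auto
      define h where "h = min s r / 2"
      have h: "h > 0" "h < s" "h < r" using s r by (auto simp: h_def)
      show False using s(2)[OF h(1,2)] \<psi>[of "y - h"] S_mono[of "y - h" y] h by simp
    qed
    ultimately have "\<bar>d\<bar>\<^sup>2 \<le> (g y)\<^sup>2" by (intro power_mono) auto
    then show "separable_ham a b C0 x y (p + deriv \<phi> y) - (0 + C0) \<le> 0"
      using g2[of y] by (simp add: separable_ham_def d_def[symmetric] power2_eq_square)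
  qed
  moreover have "visc_supersol (\<lambda>y q. separable_ham a b C0 x y (p + q) - (0 + C0)) v"
    unfolding visc_supersol_def
  proof (intro allI impI, elim conjE)
    fix \<phi> y assume \<phi>: "\<phi> C1_differentiable_on UNIV" and ev: "\<forall>\<^sub>F z in nhds y. v z - \<phi> z \<ge> v y - \<phi> y"
    define m where "m = n y"
    define f where "f = (\<lambda>z. S z - of_int m * P)"
    have f': "(f has_real_derivative g z) (at z)" for z
      unfolding f_def by (auto intro!: derivative_eq_intros S')
    show "separable_ham a b C0 x y (p + deriv \<phi> y) - (0 + C0) \<ge> 0"
    proof (cases "f y = 0")
      case True
      \<comment> \<open>If \<open>S\<close> takes the value of a vertex at a point other than the vertex, it is constant in between.\<close>
      have "g y = 0"
      proof (rule ccontr)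
        assume "g y \<noteq> 0"
        then have gp: "g y > 0" using gn[of y] by simp
        let ?z = "y0 + of_int m"
        have Sy: "S y = S ?z" using True Sint[of m] by (simp add: f_def)
        consider "y < ?z" | "y > ?z" | "y = ?z" by linarith
        then show False
        proof cases
          case 1
          obtain s where s: "s > 0" "\<And>h. h > 0 \<Longrightarrow> h < s \<Longrightarrow> S y < S (y + h)"
            using DERIV_pos_inc_right[OF S' gp] by auto
          define h where "h = min s (?z - y) / 2"
          have h: "h > 0" "h < s" "y + h \<le> ?z" using s 1 by (auto simp: h_def min_def field_simps)
          show False using s(2)[OF h(1,2)] S_mono[OF h(3)] Sy by simp
        next
          case 2
          obtain s where s: "s > 0" "\<And>h. h > 0 \<Longrightarrow> h < s \<Longrightarrow> S (y - h) < S y"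
            using DERIV_pos_inc_left[OF S' gp] by auto
          define h where "h = min s (y - ?z) / 2"
          have h: "h > 0" "h < s" "?z \<le> y - h" using s 2 by (auto simp: h_def min_def field_simps)
          show False using s(2)[OF h(1,2)] S_mono[OF h(3)] Sy by simp
        next
          case 3
          have "one_periodic b" using b by (simp add: one_periodic_def)
          then have "b y = 0" using one_periodic_add_int[of b y0 m] y0 3 by simp
          then show False using g2[of y] gp by simp
        qed
      qed
      then have ab0: "a x * b y = 0" using g2[of y] by simp
      show ?thesis unfolding separable_ham_def ab0 by simp
    next
      case False
      define \<sigma> where "\<sigma> = sgn (f y)"
      have \<sigma>: "\<sigma> * f y > 0" "\<sigma> * \<sigma> = 1" using False by (auto simp: \<sigma>_def sgn_if)
      define l where "l = (\<lambda>z. of_int m * p + \<sigma> * f z - p * z)"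
      have l': "(l has_real_derivative \<sigma> * g y - p) (at y)"
        unfolding l_def by (auto intro!: derivative_eq_intros f')
      have "isCont (\<lambda>z. \<sigma> * f z) y" using DERIV_isCont[OF f'[of y]] by (intro continuous_intros)
      then have "((\<lambda>z. \<sigma> * f z) \<longlongrightarrow> \<sigma> * f y) (nhds y)" 
        using tendsto_at_iff_tendsto_nhds[of "\<lambda>z. \<sigma> * f z" y] by (simp add: isCont_def)
      then have "\<forall>\<^sub>F z in nhds y. 0 < \<sigma> * f z" using \<sigma>(1) by (rule order_tendstoD)
      then have "\<forall>\<^sub>F z in nhds y. l z - \<phi> z \<ge> l y - \<phi> y"
        using ev
      proof eventually_elim
        case (elim z)
        have abs: "\<bar>f z\<bar> = \<sigma> * f z" if "0 < \<sigma> * f z" for z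
          using that False unfolding \<sigma>_def by (auto simp: sgn_if zero_less_mult_iff split: if_splits)
        have "w z \<le> W m z" unfolding w_def by (rule n)
        then have "v z \<le> l z" using abs[OF elim(1)] by (simp add: v_def l_def W_def f_def)
        moreover have "v y = l y" using abs[OF \<sigma>(1)] by (simp add: v_def l_def W_def f_def w_def m_def)
        ultimately show ?case using elim(2) by linarith
      qed
      from deriv_eq_of_touching_below[OF \<phi> l' this] have "p + deriv \<phi> y = \<sigma> * g y" by simp
      moreover have "(\<sigma> * g y)\<^sup>2 = (\<sigma> * \<sigma>) * (g y * g y)" by (simp add: power2_eq_square)
      ultimately show ?thesis using \<sigma>(2) g2[of y] by (simp add: separable_ham_def)
    qed
  qed
  ultimately show ?thesis unfolding cell_solution_def by blast
qed

text \<open>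
The mean momentum at the energy \<open>p\<^sup>2 / 2\<close> of a free particle is at least \<open>\<bar>p\<bar>\<close>, so that the
intermediate value theorem yields the level of the smooth corrector.
\<close>

lemma effective_ham_characterisation:
  fixes C0 :: real
  assumes y0: "b y0 = 0"
  defines "h \<equiv> (\<lambda>x p. effective_ham (separable_ham a b C0) x p - C0)"
  shows "h x p \<ge> 0" "\<bar>p\<bar> \<le> mean_momentum a b x (h x p)" "h x p > 0 \<Longrightarrow> \<bar>p\<bar> = mean_momentum a b x (h x p)"
proof -
  have "\<exists>e\<ge>0. \<bar>p\<bar> \<le> mean_momentum a b x e \<and> (e > 0 \<longrightarrow> \<bar>p\<bar> = mean_momentum a b x e) \<and>
      (\<exists>v. cell_solution (separable_ham a b C0) x p (e + C0) v)"
  proof (cases "\<bar>p\<bar> < mean_momentum a b x 0")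
    case True
    then show ?thesis using cell_solution_flat[OF y0 True] by force
  next
    case False
    have "\<bar>p\<bar> = sqrt (2 * (p\<^sup>2 / 2))" by simp
    also have "\<dots> \<le> mean_momentum a b x (p\<^sup>2 / 2)" by (rule mean_momentum_ge) simp
    finally have le: "\<bar>p\<bar> \<le> mean_momentum a b x (p\<^sup>2 / 2)" .
    have "continuous_on UNIV (\<lambda>e. case (e, x) of (e, x) \<Rightarrow> mean_momentum a b x e)"
      by (rule continuous_on_compose2[OF continuous_mean_momentum]) (auto intro!: continuous_intros)
    then have "continuous_on {0..p\<^sup>2 / 2} (\<lambda>e. mean_momentum a b x e)"
      by (auto intro: continuous_on_subset)
    then obtain e where "0 \<le> e" "mean_momentum a b x e = \<bar>p\<bar>"
      using IVT'[of "\<lambda>e. mean_momentum a b x e" 0 "\<bar>p\<bar>" "p\<^sup>2 / 2"] False le by auto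
    then show ?thesis using cell_solution_rotation[of e p x C0] by (metis order_refl)
  qed
  then obtain e v where e: "e \<ge> 0" "\<bar>p\<bar> \<le> mean_momentum a b x e" "e > 0 \<longrightarrow> \<bar>p\<bar> = mean_momentum a b x e"
    and "cell_solution (separable_ham a b C0) x p (e + C0) v" by blast
  then have "h x p = e"
    using effective_ham_eq[of a x b C0 p] a(2)[of x] b(1) by (simp add: h_def)
  with e show "h x p \<ge> 0" "\<bar>p\<bar> \<le> mean_momentum a b x (h x p)" "h x p > 0 \<Longrightarrow> \<bar>p\<bar> = mean_momentum a b x (h x p)"
    by auto
qed

end

section \<open>The rate of convergence\<close>

lemma C1_with_partials_diff_time:
  assumes "C1_with_partials \<phi> \<phi>x \<phi>t"
  shows "C1_with_partials (\<lambda>z. \<phi> z - c * snd z) \<phi>x (\<lambda>z. \<phi>t z - c)"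
  unfolding C1_with_partials_def
proof (intro conjI ballI)
  fix z :: "real \<times> real" assume "z \<in> UNIV \<times> {0<..}"
  then have "(\<phi> has_derivative (\<lambda>(h, k). \<phi>x z * h + \<phi>t z * k)) (at z)"
    using assms by (auto simp: C1_with_partials_def)
  then show "((\<lambda>z. \<phi> z - c * snd z) has_derivative (\<lambda>(h, k). \<phi>x z * h + (\<phi>t z - c) * k)) (at z)"
    by (auto intro!: derivative_eq_intros simp: case_prod_unfold algebra_simps)
qed (use assms in \<open>auto simp: C1_with_partials_def intro!: continuous_intros\<close>)

lemma cauchy_solution_add_constant:
  assumes "cauchy_solution (\<lambda>x p. F x p + c) u0 u"
  shows "cauchy_solution F u0 (\<lambda>z. u z + c * snd z)"
proof -
  have u: "continuous_on (UNIV \<times> {0..}) u" "\<And>T. bounded (u ` (UNIV \<times> {0..T}))" "\<And>x. u (x, 0) = u0 x"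
    "evol_visc_subsol (\<lambda>x p. F x p + c) u" "evol_visc_supersol (\<lambda>x p. F x p + c) u"
    using assms by (auto simp: cauchy_solution_def)
  have "bounded ((\<lambda>z. u z + c * snd z) ` (UNIV \<times> {0..T}))" for T
  proof -
    obtain N where N: "\<And>z. z \<in> UNIV \<times> {0..T} \<Longrightarrow> \<bar>u z\<bar> \<le> N"
      using u(2)[of T] unfolding bounded_iff by auto
    have "\<bar>u z + c * snd z\<bar> \<le> N + \<bar>c\<bar> * T" if "z \<in> UNIV \<times> {0..T}" for z
    proof -
      have "\<bar>c * snd z\<bar> \<le> \<bar>c\<bar> * T" using that by (auto simp: abs_mult intro!: mult_left_mono)
      then show ?thesis using N[OF that] by linarith
    qed
    then show ?thesis unfolding bounded_iff by (intro exI[of _ "N + \<bar>c\<bar> * T"]) auto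
  qed
  moreover have "evol_visc_subsol F (\<lambda>z. u z + c * snd z)"
    unfolding evol_visc_subsol_def
  proof (intro allI impI, elim conjE)
    fix \<phi> \<phi>x \<phi>t :: "real \<times> real \<Rightarrow> real" and x t :: real
    assume C1: "C1_with_partials \<phi> \<phi>x \<phi>t" and t: "0 < t"
      and ev: "\<forall>\<^sub>F z in nhds (x, t). u z + c * snd z - \<phi> z \<le> u (x, t) + c * snd (x, t) - \<phi> (x, t)"
    have "\<forall>\<^sub>F z in nhds (x, t). u z - (\<phi> z - c * snd z) \<le> u (x, t) - (\<phi> (x, t) - c * snd (x, t))"
      using ev by (rule eventually_mono) linarith
    with u(4)[unfolded evol_visc_subsol_def, rule_format, OF conjI[OF C1_with_partials_diff_time[OF C1, of c] conjI[OF t]]]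
    show "\<phi>t (x, t) + F x (\<phi>x (x, t)) \<le> 0" by simp
  qed
  moreover have "evol_visc_supersol F (\<lambda>z. u z + c * snd z)"
    unfolding evol_visc_supersol_def
  proof (intro allI impI, elim conjE)
    fix \<phi> \<phi>x \<phi>t :: "real \<times> real \<Rightarrow> real" and x t :: real
    assume C1: "C1_with_partials \<phi> \<phi>x \<phi>t" and t: "0 < t"
      and ev: "\<forall>\<^sub>F z in nhds (x, t). u z + c * snd z - \<phi> z \<ge> u (x, t) + c * snd (x, t) - \<phi> (x, t)"
    have "\<forall>\<^sub>F z in nhds (x, t). u z - (\<phi> z - c * snd z) \<ge> u (x, t) - (\<phi> (x, t) - c * snd (x, t))"
      using ev by (rule eventually_mono) linarith
    with u(5)[unfolded evol_visc_supersol_def, rule_format, OF conjI[OF C1_with_partials_diff_time[OF C1, of c] conjI[OF t]]]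
    show "\<phi>t (x, t) + F x (\<phi>x (x, t)) \<ge> 0" by simp
  qed
  ultimately show ?thesis
    using u(1,3) unfolding cauchy_solution_def by (auto intro!: continuous_intros)
qed

lemma (in energy_profile) action_le:
  assumes e: "e > 0" and B: "\<And>x. G x e \<le> B"
  shows "action e x y \<le> B * \<bar>x - y\<bar>"
proof -
  have "norm (primitive (\<lambda>z. G z e) x - primitive (\<lambda>z. G z e) y) \<le> B * norm (x - y)"
  proof (rule field_differentiable_bound[of UNIV])
    show "(primitive (\<lambda>z. G z e) has_real_derivative G z e) (at z within UNIV)" for z
      using primitive_derivative[OF G_continuous[OF e]] by simp
    show "norm (G z e) \<le> B" for z using B[of z] G_pos[OF e, of z] by simp
  qed auto
  then show ?thesis by (simp add: action_def)
qed

lemma (in energy_profile) action_commute: "action e x y = action e y x"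
  by (simp add: action_def abs_minus_commute)

lemma (in energy_profile) travel_time_commute: "travel_time e x y = travel_time e y x"
  by (simp add: travel_time_def abs_minus_commute)

text \<open>
If enough time is left, the particle goes to the rest point \<open>z\<close> with energy 1, waits there for free
and returns, which takes time at most \<open>2 * \<epsilon>\<close> and has an action of order \<open>\<epsilon>\<close>.  If there is too little
time for the detour, it waits where it is, which costs at most \<open>m\<close> per unit of time.
\<close>

lemma (in energy_profile) subsol_wait_near_rest_point:
  assumes sub: "evol_visc_subsol H u" and u: "continuous_on (UNIV \<times> {0..}) u"
    and k: "continuous_on UNIV k" "\<And>x p. k x \<le> H x p"
    and z: "k z = 0" "\<bar>x - z\<bar> \<le> \<epsilon>" and m: "- m \<le> k x" "m \<ge> 0" and B: "\<And>x. G x 1 \<le> B"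
    and st: "0 \<le> s" "s \<le> t"
  shows "u (x, t) \<le> u (x, s) + \<epsilon> * (2 * m + 2 * B)"
proof -
  define \<theta> where "\<theta> = travel_time 1 x z"
  have \<epsilon>: "\<epsilon> \<ge> 0" using z by linarith
  have "\<theta> \<le> \<bar>x - z\<bar> / sqrt (2 * 1)" unfolding \<theta>_def by (rule travel_time_le) simp
  also have "\<dots> \<le> \<epsilon> / 1" using z(2) by (intro frac_le) auto
  finally have \<theta>: "0 \<le> \<theta>" "\<theta> \<le> \<epsilon>" using travel_time_nonneg by (auto simp: \<theta>_def)
  have B0: "B \<ge> 0" using B[of 0] G_pos[of 1 0] by simp
  have act: "action 1 x z \<le> B * \<epsilon>"
    using action_le[of 1 B x z] B z(2) mult_left_mono[OF z(2) B0] by simp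
  show ?thesis
  proof (cases "2 * \<theta> \<le> t - s")
    case True
    have "u (z, s + \<theta>) \<le> u (x, s) + action 1 x z"
      using subsol_travel[OF sub u _ st(1), of 1 z x] \<theta>(1) travel_time_commute[of 1 x z] action_commute[of 1 x z]
      by (simp add: \<theta>_def)
    moreover have "u (z, t - \<theta>) \<le> u (z, s + \<theta>)"
      using subsol_wait[OF sub u k, of "s + \<theta>" "t - \<theta>" z] True st \<theta> z(1) by simp
    moreover have "u (x, t) \<le> u (z, t - \<theta>) + action 1 x z"
      using subsol_travel[OF sub u, of 1 "t - \<theta>" x z] True st \<theta>(1) by (simp add: \<theta>_def)
    moreover have "\<epsilon> * (2 * m + 2 * B) = \<epsilon> * (2 * m) + 2 * (B * \<epsilon>)" "\<epsilon> * (2 * m) \<ge> 0"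
      using \<epsilon> m by (auto simp: algebra_simps)
    ultimately show ?thesis using act by linarith
  next
    case False
    have "u (x, t) \<le> u (x, s) - k x * (t - s)" by (rule subsol_wait[OF sub u k st])
    moreover have "- k x * (t - s) \<le> m * (2 * \<epsilon>)"
      using m st False \<theta> by (intro mult_mono) auto
    ultimately have "u (x, t) \<le> u (x, s) + m * (2 * \<epsilon>)" by simp
    moreover have "\<epsilon> * (2 * m + 2 * B) = m * (2 * \<epsilon>) + 2 * (B * \<epsilon>)" "B * \<epsilon> \<ge> 0"
      using \<epsilon> B0 by (auto simp: algebra_simps)
    ultimately show ?thesis by linarith
  qed
qed

lemma lip_const_lipschitz:
  assumes "f \<in> Lip"
  shows "(lip_const f)-lipschitz_on UNIV f"
proof -
  let ?A = "{L. L-lipschitz_on UNIV f}"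
  have ne: "?A \<noteq> {}" using assms by (auto simp: Lip_def)
  have bd: "\<And>L. L \<in> ?A \<Longrightarrow> 0 \<le> L" by (auto intro: lipschitz_on_nonneg)
  show ?thesis
  proof (rule lipschitz_onI)
    show "0 \<le> lip_const f" unfolding lip_const_def using ne bd by (intro cInf_greatest) auto
    fix x y
    show "dist (f x) (f y) \<le> lip_const f * dist x y"
    proof (cases "x = y")
      case False
      then have d: "dist x y > 0" by simp
      have "dist (f x) (f y) / dist x y \<le> lip_const f"
        unfolding lip_const_def
      proof (rule cInf_greatest[OF ne])
        fix L assume "L \<in> ?A"
        then have "dist (f x) (f y) \<le> L * dist x y" by (auto intro: lipschitz_onD)
        then show "dist (f x) (f y) / dist x y \<le> L" using d by (simp add: field_simps)
      qed
      then show ?thesis using d by (simp add: field_simps)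
    qed simp
  qed
qed

lemma Linf_norm_le:
  assumes "continuous_on (UNIV \<times> {0..}) f" "\<And>x t. x \<in> {l..r} \<Longrightarrow> t \<in> {0..T} \<Longrightarrow> \<bar>f (x, t)\<bar> \<le> B"
  shows "Linf_norm ({l..r} \<times> {0..T}) f \<le> ereal B"
  unfolding Linf_norm_def
proof (rule esssup_I)
  let ?S = "{l..r} \<times> {0..T}"
  have "continuous_on ?S f" using assms(1) by (rule continuous_on_subset) auto
  moreover have S: "?S \<in> sets lebesgue"
    by (intro lmeasurable_compact[THEN fmeasurableD] compact_Times) auto
  ultimately have "f \<in> borel_measurable (lebesgue_on ?S)"
    by (rule continuous_imp_measurable_on_sets_lebesgue)
  then show "(\<lambda>z. ereal \<bar>f z\<bar>) \<in> borel_measurable (lebesgue_on ?S)" by measurable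
  show "AE z in lebesgue_on ?S. ereal \<bar>f z\<bar> \<le> ereal B"
    using S by (intro AE_I2) (auto simp: space_restrict_space assms(2))
qed

lemma C1_lipschitz_on_interval:
  fixes a :: "real \<Rightarrow> real"
  assumes "a C1_differentiable_on UNIV"
  obtains \<Lambda> where "\<And>z z'. z \<in> {l..r} \<Longrightarrow> z' \<in> {l..r} \<Longrightarrow> \<bar>a z - a z'\<bar> \<le> \<Lambda> * \<bar>z - z'\<bar>"
proof -
  obtain D where D: "\<And>x. (a has_vector_derivative D x) (at x)" "continuous_on UNIV D"
    using assms by (auto simp: C1_differentiable_on_def)
  have "compact (D ` {l..r})"
    using D(2) by (intro compact_continuous_image) (auto intro: continuous_on_subset)
  then obtain \<Lambda> where \<Lambda>: "\<And>z. z \<in> {l..r} \<Longrightarrow> \<bar>D z\<bar> \<le> \<Lambda>"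
    using compact_imp_bounded[of "D ` {l..r}"] unfolding bounded_iff by (metis imageI real_norm_def)
  have "norm (a z - a z') \<le> \<Lambda> * norm (z - z')" if "z \<in> {l..r}" "z' \<in> {l..r}" for z z'
    using that
    by (intro field_differentiable_bound[of "{l..r}" a D])
      (use D(1) \<Lambda> in \<open>auto simp: has_real_derivative_iff_has_vector_derivative intro: has_vector_derivative_at_within\<close>)
  then show thesis by (intro that) auto
qed

theorem theorem1p3:
  fixes a :: "real \<Rightarrow> real" and R T L M :: real
  assumes "a C1_differentiable_on UNIV" and "bounded (range a)" and "\<forall>x. a x > 0"
    and "R > 0" and "T > 0"
  shows "\<exists>C::real. \<forall>(b::real \<Rightarrow> real) (C0::real) (u0::real \<Rightarrow> real) (u::real \<times> real \<Rightarrow> real).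
    continuous_on UNIV b \<and> one_periodic b \<and> is_max b 0 \<and> is_max (\<lambda>y. \<bar>b y\<bar>) M \<and>
    u0 \<in> Lip \<inter> BUC \<and> lip_const u0 = L \<and>
    effective_solution (separable_ham a b C0) u0 u \<longrightarrow>
    (\<forall>\<epsilon> \<in> {0<..<1}. \<forall>u\<epsilon>. oscillatory_solution (separable_ham a b C0) \<epsilon> u0 u\<epsilon> \<longrightarrow>
       Linf_norm ({-R..R} \<times> {0..T}) (\<lambda>z. u\<epsilon> z - u z) \<le> ereal (C * \<epsilon>))"
proof -
  have a_cont: "continuous_on UNIV a"
    using C1_imp_deriv[OF assms(1)] by (rule continuous_on_of_has_real_derivative)
  have a_pos: "\<And>x. a x > 0" using assms(3) by blast
  define K where "K = (L + 1)\<^sup>2 / 2 * T"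
  have K0: "K \<ge> 0" using assms(5) by (simp add: K_def)
  define J where "J = {- (R + K) - 1..R + K + 1}"
  obtain A where A: "\<And>x. a x \<le> A"
    using assms(2) unfolding bounded_iff by (auto simp: abs_le_iff)
  obtain \<Lambda> where \<Lambda>: "\<And>z z'. z \<in> J \<Longrightarrow> z' \<in> J \<Longrightarrow> \<bar>a z - a z'\<bar> \<le> \<Lambda> * \<bar>z - z'\<bar>"
    using C1_lipschitz_on_interval[OF assms(1)] unfolding J_def by metis
  have "J \<noteq> {}" "compact J" "continuous_on J a"
    using K0 assms(4) a_cont by (auto simp: J_def intro: continuous_on_subset)
  then obtain zmin where "zmin \<in> J" "\<And>z. z \<in> J \<Longrightarrow> a zmin \<le> a z"
    using continuous_attains_inf by metis
  then obtain \<alpha> where \<alpha>: "\<alpha> > 0" "\<And>z. z \<in> J \<Longrightarrow> \<alpha> \<le> a z" using a_pos by metis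
  \<comment> \<open>The averaging error and the cost of waiting in the oscillatory problem, both divided by \<open>\<epsilon>\<close>.\<close>
  define cA where "cA = sqrt (M / (2 * \<alpha>)) * \<Lambda> * K + sqrt (2 * A * M)"
  define cW where "cW = 2 * (A * M) + 2 * sqrt (2 * (1 + A * M))"
  have main: "Linf_norm ({-R..R} \<times> {0..T}) (\<lambda>z. u\<epsilon> z - u z) \<le> ereal ((cA + cW) * \<epsilon>)"
    if torus: "continuous_on UNIV b" "one_periodic b" "is_max b 0" "is_max (\<lambda>y. \<bar>b y\<bar>) M"
      and u0: "u0 \<in> Lip" "lip_const u0 = L"
      and eff: "effective_solution (separable_ham a b C0) u0 u"
      and \<epsilon>: "\<epsilon> \<in> {0<..<1}" and osc: "oscillatory_solution (separable_ham a b C0) \<epsilon> u0 u\<epsilon>"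
    for b C0 u0 u \<epsilon> u\<epsilon>
  proof -
    interpret separable_potential a b
      using a_cont a_pos torus by unfold_locales (auto simp: is_max_def one_periodic_def)
    obtain y0 where y0: "b y0 = 0" using torus(3) by (auto simp: is_max_def)
    have abs_b: "\<bar>b y\<bar> \<le> M" for y using torus(4) by (simp add: is_max_def)
    have bM: "- M \<le> b y" "M \<ge> 0" for y
      using abs_b[of y] by linarith+
    have A0: "A \<ge> 0" using A[of 0] a_pos[of 0] by linarith
    have AM: "- (a x * b y) \<le> A * M" for x y
    proof -
      have "a x * (- b y) \<le> A * M"
        using A[of x] bM(1)[of y] a_pos[of x] torus(3) bM(2)
        by (intro mult_mono) (auto simp: is_max_def)
      then show ?thesis by simp
    qed
    have L: "L-lipschitz_on UNIV u0" using lip_const_lipschitz[OF u0(1)] u0(2) by simp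
    define k where "k = (\<lambda>x. - (a x * b (x / \<epsilon>)))"
    have k: "continuous_on UNIV k" "\<And>x. k x \<ge> 0"
      using \<epsilon> ab by (auto simp: k_def intro!: continuous_intros a_cont continuous_on_compose2[OF torus(1)])
    define H1 where "H1 = (\<lambda>x p. 1/2 * p\<^sup>2 - k x)"
    define G1 where "G1 = (\<lambda>x e. sqrt (2 * (e + k x)))"
    define D1 where "D1 = (\<lambda>x e. 1 / sqrt (2 * (e + k x)))"
    define H2 where "H2 = (\<lambda>x p. effective_ham (separable_ham a b C0) x p - C0)"
    define G2 where "G2 = mean_momentum a b"
    define D2 where "D2 = mean_slowness a b"
    have P1: "energy_profile H1 G1 D1"
      unfolding H1_def G1_def D1_def by (rule mechanical_energy_profile[OF k])
    have P2: "energy_profile H2 G2 D2"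
      unfolding H2_def G2_def D2_def
      by (rule effective_energy_profile) (use effective_ham_characterisation[OF y0] in blast)+
    interpret E1: energy_profile H1 G1 D1 by (rule P1)
    interpret E2: energy_profile H2 G2 D2 by (rule P2)
    define v1 where "v1 = (\<lambda>z. u\<epsilon> z + C0 * snd z)"
    define v2 where "v2 = (\<lambda>z. u z + C0 * snd z)"
    have "(\<lambda>x p. H1 x p + C0) = (\<lambda>x p. separable_ham a b C0 x (x / \<epsilon>) p)"
      by (auto simp: H1_def k_def separable_ham_def fun_eq_iff)
    then have v1: "cauchy_solution H1 u0 v1"
      unfolding v1_def using osc by (intro cauchy_solution_add_constant) (simp add: oscillatory_solution_def)
    have "(\<lambda>x p. H2 x p + C0) = effective_ham (separable_ham a b C0)"
      by (auto simp: H2_def fun_eq_iff)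
    then have v2: "cauchy_solution H2 u0 v2"
      unfolding v2_def using eff by (intro cauchy_solution_add_constant) (simp add: effective_solution_def)
    have act: "\<bar>E1.action e x y - E2.action e x y\<bar> \<le> cA * \<epsilon>"
      if x: "x \<in> {-R..R}" and xy: "\<bar>x - y\<bar> \<le> K" and e: "e > 0" for x y e
    proof -
      define l r where "l = min x y" and "r = max x y"
      have lr: "-(R + K) \<le> l" "l \<le> r" "r \<le> R + K" "r - l = \<bar>x - y\<bar>"
        using x xy by (auto simp: l_def r_def)
      have "\<bar>integral {l..r} (\<lambda>z. G1 z e) - integral {l..r} (\<lambda>z. G2 z e)\<bar>
          \<le> \<epsilon> * (sqrt (M / (2 * \<alpha>)) * \<Lambda> * (r - l) + sqrt (2 * A * M))"
        using averaging_error[of M A \<alpha> "R + K" \<Lambda> \<epsilon> e l r, OF bM(1) A \<alpha>(1) \<alpha>(2) \<Lambda>] \<epsilon> e lr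
        by (simp add: G1_def G2_def k_def J_def)
      also have "\<dots> \<le> \<epsilon> * cA"
      proof -
        have "\<Lambda> \<ge> 0" using \<Lambda>[of R "R + 1"] assms(4) K0 by (auto simp: J_def)
        then show ?thesis unfolding cA_def using \<epsilon> xy lr(4) bM(2) \<alpha>(1)
          by (intro mult_left_mono add_right_mono) auto
      qed
      finally have i: "\<bar>integral {l..r} (\<lambda>z. G1 z e) - integral {l..r} (\<lambda>z. G2 z e)\<bar> \<le> cA * \<epsilon>"
        by (simp add: mult.commute)
      have "\<bar>E1.action e x y - E2.action e x y\<bar> \<le> \<bar>integral {l..r} (\<lambda>z. G1 z e) - integral {l..r} (\<lambda>z. G2 z e)\<bar>"
        using primitive_diff[OF E1.G_continuous[OF e] lr(2)] primitive_diff[OF E2.G_continuous[OF e] lr(2)]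
        unfolding E1.action_def E2.action_def by (auto simp: l_def r_def min_def max_def split: if_splits)
      with i show ?thesis by linarith
    qed
    have upper: "v1 (x, t) \<le> v2 (x, t) + (cA * \<epsilon> + cW * \<epsilon>)" if x: "x \<in> {-R..R}" and t: "t \<in> {0..T}" for x t
    proof (rule subsol_le_supersol[OF P1 P2])
      show "E1.action e x y \<le> E2.action e x y + cA * \<epsilon>" if "\<bar>x - y\<bar> \<le> (L + 1)\<^sup>2 / 2 * T" "e > 0" for y e
        using act[OF x, of y e] that by (simp add: K_def)
      fix s assume s: "0 \<le> s" "s \<le> t"
      \<comment> \<open>\<open>z\<close> is a zero of \<open>b (\<cdot> / \<epsilon>)\<close> to the left of \<open>x\<close>.\<close>
      define n where "n = \<lfloor>x / \<epsilon> - y0\<rfloor>"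
      define z where "z = \<epsilon> * (y0 + of_int n)"
      have "x / \<epsilon> - (y0 + of_int n) \<ge> 0" "x / \<epsilon> - (y0 + of_int n) \<le> 1" unfolding n_def by linarith+
      moreover have "x - z = \<epsilon> * (x / \<epsilon> - (y0 + of_int n))" using \<epsilon> by (simp add: z_def algebra_simps)
      ultimately have xz: "\<bar>x - z\<bar> \<le> \<epsilon>" using \<epsilon> by (simp add: mult_left_le)
      have bz: "k z = 0" using \<epsilon> y0 one_periodic_add_int[OF torus(2), of y0 n] by (simp add: k_def z_def)
      have "v1 (x, t) \<le> v1 (x, s) + \<epsilon> * (2 * (A * M) + 2 * sqrt (2 * (1 + A * M)))"
      proof (rule E1.subsol_wait_near_rest_point[where k = "\<lambda>x. - k x", OF _ _ _ _ _ xz _ _ _ s])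
        show "continuous_on UNIV (\<lambda>x. - k x)" using k(1) by (intro continuous_intros)
        show "- k x \<le> H1 x p" for x p by (simp add: H1_def)
        show "- (A * M) \<le> - k x" using AM[of x "x / \<epsilon>"] by (simp add: k_def)
        show "G1 x 1 \<le> sqrt (2 * (1 + A * M))" for x
          using AM[of x "x / \<epsilon>"] by (simp add: G1_def k_def)
      qed (use v1 bz A0 bM(2) in \<open>auto simp: cauchy_solution_def\<close>)
      then show "v1 (x, t) \<le> v1 (x, s) + cW * \<epsilon>" by (simp add: cW_def mult.commute)
    qed (use v1 v2 L t in \<open>auto simp: cauchy_solution_def\<close>)
    have lower: "v2 (x, t) \<le> v1 (x, t) + (cA * \<epsilon> + 0)" if x: "x \<in> {-R..R}" and t: "t \<in> {0..T}" for x t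
    proof (rule subsol_le_supersol[OF P2 P1])
      show "E2.action e x y \<le> E1.action e x y + cA * \<epsilon>" if "\<bar>x - y\<bar> \<le> (L + 1)\<^sup>2 / 2 * T" "e > 0" for y e
        using act[OF x, of y e] that by (simp add: K_def)
      fix s assume s: "0 \<le> s" "s \<le> t"
      have "v2 (x, t) \<le> v2 (x, s) - 0 * (t - s)"
      proof (rule subsol_wait[where k = "\<lambda>_. 0", OF _ _ _ _ s])
        show "0 \<le> H2 x p" for x p using effective_ham_characterisation(1)[OF y0] by (simp add: H2_def)
      qed (use v2 in \<open>auto simp: cauchy_solution_def\<close>)
      then show "v2 (x, t) \<le> v2 (x, s) + 0" by simp
    qed (use v1 v2 L t in \<open>auto simp: cauchy_solution_def\<close>)
    have cW0: "cW * \<epsilon> \<ge> 0" using A0 bM(2) \<epsilon> by (auto simp: cW_def)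
    show ?thesis
    proof (rule Linf_norm_le)
      show "continuous_on (UNIV \<times> {0..}) (\<lambda>z. u\<epsilon> z - u z)"
        using osc eff by (auto simp: oscillatory_solution_def effective_solution_def cauchy_solution_def
            intro!: continuous_intros)
      fix x t assume "x \<in> {-R..R}" "t \<in> {0..T}"
      from upper[OF this] lower[OF this] show "\<bar>u\<epsilon> (x, t) - u (x, t)\<bar> \<le> (cA + cW) * \<epsilon>"
        using cW0 by (simp add: v1_def v2_def abs_le_iff algebra_simps)
    qed
  qed
  show ?thesis by (intro exI[of _ "cA + cW"] allI impI ballI main; elim conjE IntE; assumption)
qed

end
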